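(* Let $G$ be a $(q+1)$-regular connected finite graph of genus $g$ (for an integer $q$), and let $\theta$ be its canonical character. Then for every $\omega\in\Omega(G)$, $\rho(A_\omega)\le q+1$ and $\rho(W_{1,\omega})\le q$. Specifically: (a) if $\underline{\omega}=0$, then $q+1\in\operatorname{spec}A_\omega$ and $q\in\operatorname{spec}W_{1,\omega}$, both with multiplicity $1$; (b) if $\underline{\omega}=\theta$, then $-(q+1)\in\operatorname{spec}A_\omega$ and $-q\in\operatorname{spec}W_{1,\omega}$, both with multiplicity $1$; (c) if $\underline{\omega}\notin\{0,\theta\}$, then $\rho(A_\omega)<q+1$, and if in addition $g\ge2$, then $\rho(W_{1,\omega})<q$; (d) if $G$ is bipartite, then $\theta=0$, and if in addition $g\ge 2$, then $|\lambda|<q$ for all $\lambda\in\operatorname{spec}W_{1,\omega}\setminus\{\pm q\}$ when $\underline{\omega}=0$; (e) if $G$ is non-bipartite, then $\theta\neq0$, and (i) if $\underline{\omega}=0$, then $-(q+1)\notin\operatorname{spec}A_\omega$, and if in addition $g\ge2$, then $|\lambda|<q$ for all $\lambda\in\operatorname{spec}W_{1,\omega}\setminus\{q\}$; (ii) if $\underline{\omega}=\theta$, then $q+1\notin\operatorname{spec}A_\omega$, and if in addition $g\ge 2$, then $|\lambda|<q$ for all $\lambda\in\operatorname{spec}W_{1,\omega}\setminus\{-q\}$.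
   Context: $G$ is a connected finite graph (multiple edges and loops allowed) with $n$ vertices and $m$ edges, genus $g=m-n+1$. Each edge gives two mutually inverse oriented edges; $\mathbf E(G)$ is the set of $2m$ oriented edges; $\mathbf a(0),\mathbf a(1)$ are the initial and terminal vertices of $\mathbf a$ and $\mathbf a^{-1}$ its inverse. Fix an orientation with positively oriented edges $\mathbf e_1,\dots,\mathbf e_m$; $\mathcal T(G)$ is the real vector space with basis $\mathbf e_1,\dots,\mathbf e_m$ (with $\mathbf e_i^{-1}=-\mathbf e_i$), $\Omega(G)$ its dual with dual basis $d\mathbf e_i$, orthonormal for the inner product. $H_1(G,\mathbb Z)$ is the set of integer combinations $\sum c_i\mathbf e_i$ with zero boundary $\sum c_i(\mathbf e_i(1)-\mathbf e_i(0))$. A $1$-form $\sum\omega_i d\mathbf e_i$ is harmonic if at each vertex $v$, $\sum_{\mathbf e_i(1)=v}\omega_i=\sum_{\mathbf e_i(0)=v}\omega_i$; exact if it equals $\sum_i(f(\mathbf e_i(1))-f(\mathbf e_i(0)))d\mathbf e_i$ for some $f:V(G)\to\mathbb R$; $\Omega(G)$ is the orthogonal sum of harmonic forms $\mathcal H^1(G)$ and exact forms, and $\phi_1(\omega)$ is the harmonic component. $H_1(G,\mathbb Z)^\vee=\{\eta\in\mathcal H^1(G):\eta(H_1(G,\mathbb Z))\subseteq\mathbb Z\}$, $\mathcal X=\mathcal H^1(G)/H_1(G,\mathbb Z)^\vee$, $\underline{\omega}=\phi_1(\omega)+H_1(G,\mathbb Z)^\vee$. $\chi_\omega(\alpha)=\exp(2\pi\sqrt{-1}\,\omega(\alpha))$.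 The canonical character is $\theta=\underline{\omega_O}$ where $\omega_O=\frac12\sum_{i=1}^m d\mathbf e_i$. $A_\omega$ is the $n\times n$ matrix with $(A_\omega)_{vw}=\sum_{\mathbf e(0)=v,\mathbf e(1)=w}\chi_\omega(\mathbf e)$; $\mathbf a$ feeds into $\mathbf b$ if $\mathbf a(1)=\mathbf b(0)$ and $\mathbf b\neq\mathbf a^{-1}$; $W_{1,\omega}$ is the $2m\times2m$ matrix with $(W_{1,\omega})_{\mathbf a\mathbf b}=\chi_\omega(\mathbf b)$ if $\mathbf a$ feeds into $\mathbf b$ and $0$ otherwise. $\operatorname{spec}$ is the multiset of eigenvalues and $\rho$ the spectral radius.
   Formalization: For W_1, multiplicity 1 in (a), (b) is claimed only for g>=2 (it fails for cycles and for a single edge), and rho(W_1)<=q and membership of q or -q in spec W_1 only for q>=0 (for q=-1, W_1 is the empty matrix). *)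

theory Defs
  imports
    "Graph_Theory.Digraph_Component"
    "Jordan_Normal_Form.Spectral_Radius"
begin

text \<open>
  A finite graph with multiple edges and loops, together with a chosen orientation, is a
  \<^locale>\<open>fin_digraph\<close>: the arcs are the positively oriented edges.  Each arc \<open>e\<close> gives two mutually
  inverse oriented edges, \<open>(e, True)\<close> for \<open>e\<close> itself and \<open>(e, False)\<close> for its inverse; a loop
  gives two as well.
\<close>

type_synonym 'b oedge = "'b \<times> bool"

definition oriented_edges :: "('a, 'b) pre_digraph \<Rightarrow> 'b oedge set" where
  "oriented_edges G = arcs G \<times> UNIV"

definition origin :: "('a, 'b) pre_digraph \<Rightarrow> 'b oedge \<Rightarrow> 'a" where
  "origin G a = (if snd a then tail G (fst a) else head G (fst a))"

definition terminus :: "('a, 'b) pre_digraph \<Rightarrow> 'b oedge \<Rightarrow> 'a" where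
  "terminus G a = (if snd a then head G (fst a) else tail G (fst a))"

definition reversed :: "'b oedge \<Rightarrow> 'b oedge" where
  "reversed a = (fst a, \<not> snd a)"

definition genus :: "('a, 'b) pre_digraph \<Rightarrow> int" where
  "genus G = int (card (arcs G)) - int (card (verts G)) + 1"

text \<open>A loop contributes 2 to the degree of its vertex.\<close>

definition regular_graph :: "('a, 'b) pre_digraph \<Rightarrow> int \<Rightarrow> bool" where
  "regular_graph G d \<longleftrightarrow> (\<forall>v \<in> verts G. int (in_degree G v + out_degree G v) = d)"

definition bipartite :: "('a, 'b) pre_digraph \<Rightarrow> bool" where
  "bipartite G \<longleftrightarrow> (\<exists>X Y. X \<union> Y = verts G \<and> X \<inter> Y = {} \<and>
     (\<forall>e \<in> arcs G. (tail G e \<in> X \<and> head G e \<in> Y) \<or> (tail G e \<in> Y \<and> head G e \<in> X)))"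


text \<open>
  Real chains and 1-forms are given by their coordinates in the basis of arcs and in its dual
  basis.  They are represented as functions on the arc type that vanish outside the arcs of the
  graph, so that equality of functions is equality of chains or forms.
\<close>

definition chains :: "('a, 'b) pre_digraph \<Rightarrow> ('b \<Rightarrow> real) set" where
  "chains G = {c. \<forall>e. e \<notin> arcs G \<longrightarrow> c e = 0}"

definition one_forms :: "('a, 'b) pre_digraph \<Rightarrow> ('b \<Rightarrow> real) set" where
  "one_forms G = {\<omega>. \<forall>e. e \<notin> arcs G \<longrightarrow> \<omega> e = 0}"

definition form_apply :: "('a, 'b) pre_digraph \<Rightarrow> ('b \<Rightarrow> real) \<Rightarrow> ('b \<Rightarrow> real) \<Rightarrow> real" where
  "form_apply G \<omega> c = (\<Sum>e \<in> arcs G. \<omega> e * c e)"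

definition edge_chain :: "'b oedge \<Rightarrow> 'b \<Rightarrow> real" where
  "edge_chain a = (\<lambda>e. if e = fst a then (if snd a then 1 else - 1) else 0)"

text \<open>The coefficient of \<open>v\<close> in the boundary of \<open>c\<close> is the sum over the arcs entering \<open>v\<close> minus the
  sum over the arcs leaving \<open>v\<close>; a loop at \<open>v\<close> occurs in both sums.\<close>

definition H1_int :: "('a, 'b) pre_digraph \<Rightarrow> ('b \<Rightarrow> real) set" where
  "H1_int G = {c \<in> chains G. (\<forall>e \<in> arcs G. c e \<in> \<int>) \<and>
     (\<forall>v \<in> verts G. (\<Sum>e \<in> in_arcs G v. c e) - (\<Sum>e \<in> out_arcs G v. c e) = 0)}"

definition harmonic_forms :: "('a, 'b) pre_digraph \<Rightarrow> ('b \<Rightarrow> real) set" where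
  "harmonic_forms G = {\<omega> \<in> one_forms G.
     \<forall>v \<in> verts G. (\<Sum>e \<in> in_arcs G v. \<omega> e) = (\<Sum>e \<in> out_arcs G v. \<omega> e)}"

definition exact_forms :: "('a, 'b) pre_digraph \<Rightarrow> ('b \<Rightarrow> real) set" where
  "exact_forms G = {\<omega> \<in> one_forms G.
     \<exists>f. \<forall>e \<in> arcs G. \<omega> e = f (head G e) - f (tail G e)}"

definition harmonic_part :: "('a, 'b) pre_digraph \<Rightarrow> ('b \<Rightarrow> real) \<Rightarrow> 'b \<Rightarrow> real" where
  "harmonic_part G \<omega> = (THE \<eta>. \<eta> \<in> harmonic_forms G \<and> (\<lambda>e. \<omega> e - \<eta> e) \<in> exact_forms G)"

definition H1_int_dual :: "('a, 'b) pre_digraph \<Rightarrow> ('b \<Rightarrow> real) set" where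
  "H1_int_dual G = {\<eta> \<in> harmonic_forms G. \<forall>c \<in> H1_int G. form_apply G \<eta> c \<in> \<int>}"

text \<open>Elements of the quotient of the harmonic forms by \<^const>\<open>H1_int_dual\<close> are cosets; the zero
  element is \<^const>\<open>H1_int_dual\<close> itself.\<close>

definition char_class :: "('a, 'b) pre_digraph \<Rightarrow> ('b \<Rightarrow> real) \<Rightarrow> ('b \<Rightarrow> real) set" where
  "char_class G \<omega> = {(\<lambda>e. harmonic_part G \<omega> e + \<eta> e) | \<eta>. \<eta> \<in> H1_int_dual G}"

abbreviation zero_coset :: "('a, 'b) pre_digraph \<Rightarrow> ('b \<Rightarrow> real) set" where
  "zero_coset G \<equiv> H1_int_dual G"

definition orientation_form :: "('a, 'b) pre_digraph \<Rightarrow> 'b \<Rightarrow> real" where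
  "orientation_form G = (\<lambda>e. if e \<in> arcs G then 1 / 2 else 0)"

definition canonical_char :: "('a, 'b) pre_digraph \<Rightarrow> ('b \<Rightarrow> real) set" where
  "canonical_char G = char_class G (orientation_form G)"

definition chi :: "('a, 'b) pre_digraph \<Rightarrow> ('b \<Rightarrow> real) \<Rightarrow> ('b \<Rightarrow> real) \<Rightarrow> complex" where
  "chi G \<omega> c = exp (2 * complex_of_real pi * \<i> * complex_of_real (form_apply G \<omega> c))"


text \<open>
  Matrices indexed by vertices or by oriented edges are laid out along a list enumerating the
  index set without repetition.
\<close>

definition adj_matrix ::
    "('a, 'b) pre_digraph \<Rightarrow> 'a list \<Rightarrow> ('b \<Rightarrow> real) \<Rightarrow> complex mat" where
  "adj_matrix G vs \<omega> = mat (length vs) (length vs) (\<lambda>(i, j).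
     \<Sum>a \<in> {a \<in> oriented_edges G. origin G a = vs ! i \<and> terminus G a = vs ! j}.
       chi G \<omega> (edge_chain a))"

definition feeds_into :: "('a, 'b) pre_digraph \<Rightarrow> 'b oedge \<Rightarrow> 'b oedge \<Rightarrow> bool" where
  "feeds_into G a b \<longleftrightarrow> terminus G a = origin G b \<and> b \<noteq> reversed a"

definition edge_matrix ::
    "('a, 'b) pre_digraph \<Rightarrow> 'b oedge list \<Rightarrow> ('b \<Rightarrow> real) \<Rightarrow> complex mat" where
  "edge_matrix G es \<omega> = mat (length es) (length es) (\<lambda>(i, j).
     if feeds_into G (es ! i) (es ! j) then chi G \<omega> (edge_chain (es ! j)) else 0)"

text \<open>The multiset of eigenvalues, counted with algebraic multiplicity.\<close>

definition spec :: "complex mat \<Rightarrow> complex multiset" where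
  "spec M = proots (char_poly M)"

end

theory Submission
  imports Defs
begin

text \<open>
  Both \<open>A\<^sub>\<omega>\<close> and \<open>W\<^sub>1\<^sub>,\<^sub>\<omega>\<close> are adjacency operators of \<open>d\<close>-regular digraphs (in- and out-degree \<open>d\<close>) whose
  edges carry weights \<open>w\<close> of modulus 1; for \<open>W\<^sub>1\<^sub>,\<^sub>\<omega>\<close> the vertices are the oriented edges and the edges are
  the feeding pairs.  If \<open>M x = r s x\<close> with \<open>r\<close> real and \<open>s\<close> of modulus 1, then
  \<open>\<Sum>\<^sub>e |w(e) x(e(1)) - s x(e(0))|\<^sup>2 = 2 (d - r) |x|\<^sup>2\<close>.  Hence the eigenvalues have modulus at most \<open>d\<close>, and
  \<open>d s\<close> is an eigenvalue iff some nonzero \<open>x\<close> satisfies \<open>w(e) x(e(1)) = s x(e(0))\<close> along every edge.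
  For \<open>W\<^sub>1\<^sub>,\<^sub>\<omega>\<close> with \<open>q \<ge> 2\<close>, such an \<open>x\<close> depends only on the terminal vertex and so comes from a solution
  for \<open>A\<^sub>\<omega>\<close>.  Going along an edge and back forces \<open>s = 1\<close> or \<open>s = -1\<close>, and a solution says that \<open>\<omega>\<close> is,
  modulo integer forms, exact (\<open>s = 1\<close>) or exact up to \<open>\<omega>\<^sub>O\<close> (\<open>s = -1\<close>), which identifies its class as \<open>0\<close>
  or \<open>\<theta>\<close>.  Connectedness makes \<open>x\<close> unique up to a factor, and its conjugate is a left eigenvector, so the
  algebraic multiplicity is 1.
\<close>

section \<open>Simple eigenvalues\<close>

lemma mult_mat_unit_vec:
  fixes A :: "'a :: semiring_1 mat"
  assumes "A \<in> carrier_mat m n" "j < n"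
  shows "A *\<^sub>v unit_vec n j = col A j"
  using assms by (intro eq_vecI) (auto simp: row_def)

lemma mset_spec_eigenvalue:
  assumes "A \<in> carrier_mat n n"
  shows "k \<in># spec A \<longleftrightarrow> eigenvalue A k"
proof -
  have "char_poly A \<noteq> 0"
    using degree_monic_char_poly[OF assms] by auto
  then show ?thesis
    unfolding spec_def by (simp add: eigenvalue_root_char_poly[OF assms])
qed

text \<open>A left eigenvector that is not orthogonal to \<open>x\<close> rules out a generalised eigenvector above \<open>x\<close>.\<close>

lemma count_spec_eq_1:
  fixes A :: "complex mat"
  assumes A: "A \<in> carrier_mat n n" and ev: "eigenvector A x k"
    and simple: "\<And>z. z \<in> carrier_vec n \<Longrightarrow> A *\<^sub>v z = k \<cdot>\<^sub>v z \<Longrightarrow> \<exists>c. z = c \<cdot>\<^sub>v x"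
    and y: "y \<in> carrier_vec n"
    and left: "\<And>z. z \<in> carrier_vec n \<Longrightarrow> y \<bullet> (A *\<^sub>v z) = k * (y \<bullet> z)"
    and yx: "y \<bullet> x \<noteq> 0"
  shows "count (spec A) k = 1"
proof (rule ccontr)
  assume ne: "count (spec A) k \<noteq> 1"
  have x: "x \<in> carrier_vec n" using ev A by (auto simp: eigenvector_def)
  have "k \<in># spec A"
    using ev mset_spec_eigenvalue[OF A] by (auto simp: eigenvalue_def)
  then obtain N where N: "spec A = add_mset k N" by (metis insert_DiffM)
  with ne have "k \<in># N" by (auto simp: not_in_iff)
  then obtain N' where "N = add_mset k N'" by (metis insert_DiffM)
  with N have spec: "spec A = {#k, k#} + N'" by simp
  obtain as where as: "char_poly A = (\<Prod>a\<leftarrow>as. [:- a, 1:])" using char_poly_factorized[OF A] by blast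
  have "spec A = mset as"
    unfolding spec_def as by (induction as) (simp_all add: proots_mult prod_list_zero_iff image_iff del: mult_pCons_left)
  moreover obtain rest where "mset rest = N'" using ex_mset by blast
  ultimately have "mset as = mset (k # k # rest)" using spec by simp
  then have cp: "char_poly A = (\<Prod>a\<leftarrow>k # k # rest. [:- a, 1:])"
    unfolding as by (simp only: mset_map flip: prod_mset_prod_list)
  \<comment> \<open>The Schur form carries the eigenvalues on its diagonal in the order of the given
    list. With the two copies of \<open>k\<close> in front, its upper left 2 by 2 block has
    \<open>k\<close> twice on the diagonal and an unknown entry \<open>b\<close> above it.\<close>
  obtain B P Q where "schur_decomposition A (k # k # rest) = (B, P, Q)"
    using prod_cases3 by blast
  from schur_decomposition[OF A cp this]
  have sim: "similar_mat_wit A B P Q" and upper: "upper_triangular B"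
    and diag: "diag_mat B = k # k # rest" by auto
  note w = similar_mat_witD2[OF A sim]
  have "length (diag_mat B) = n" using w(5) by (simp add: diag_mat_def)
  with diag have n: "1 < n" by auto
  have "diag_mat B ! 0 = k" "diag_mat B ! 1 = k" using diag by simp_all
  then have B00: "B $$ (0, 0) = k" and B11: "B $$ (1, 1) = k"
    using n w(5) by (simp_all add: diag_mat_def)
  \<comment> \<open>Transported by \<open>P\<close>, the first two basis vectors give an eigenvector
    \<open>f0\<close> and a vector \<open>f1\<close> with \<open>A f1 = b f0 + k f1\<close>.\<close>
  define e0 e1 :: "complex vec" where "e0 = unit_vec n 0" and "e1 = unit_vec n 1"
  define f0 f1 where "f0 = P *\<^sub>v e0" and "f1 = P *\<^sub>v e1"
  define b where "b = B $$ (0, 1)"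
  have e: "e0 \<in> carrier_vec n" "e1 \<in> carrier_vec n" by (simp_all add: e0_def e1_def)
  have f: "f0 \<in> carrier_vec n" "f1 \<in> carrier_vec n" using e w(6) by (simp_all add: f0_def f1_def)
  have "0 < n" using n by simp
  have Be0: "B *\<^sub>v e0 = k \<cdot>\<^sub>v e0"
    unfolding e0_def mult_mat_unit_vec[OF w(5) \<open>0 < n\<close>]
    using w(5) n upper B00 by (intro eq_vecI) (auto simp: upper_triangular_def)
  have Be1: "B *\<^sub>v e1 = b \<cdot>\<^sub>v e0 + k \<cdot>\<^sub>v e1"
    unfolding e0_def e1_def mult_mat_unit_vec[OF w(5) n]
    using w(5) n upper B11
    by (intro eq_vecI) (auto simp: upper_triangular_def b_def not_less less_Suc_eq_0_disj)
  have AP: "A *\<^sub>v (P *\<^sub>v v) = P *\<^sub>v (B *\<^sub>v v)" if "v \<in> carrier_vec n" for v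
  proof -
    have "A * P = P * B * (Q * P)"
      unfolding w(3) using w(5-7) by (intro assoc_mult_mat[of _ n n _ n _ n]) auto
    also have "\<dots> = P * B" using w(2,5,6) by simp
    finally show ?thesis using that w(4-6) by (metis assoc_mult_mat_vec)
  qed
  have Af0: "A *\<^sub>v f0 = k \<cdot>\<^sub>v f0"
    unfolding f0_def AP[OF e(1)] Be0 using w(6) e by (simp add: mult_mat_vec)
  have Af1: "A *\<^sub>v f1 = b \<cdot>\<^sub>v f0 + k \<cdot>\<^sub>v f1"
    unfolding f0_def f1_def AP[OF e(2)] Be1
    using w(6) e by (simp add: mult_mat_vec mult_add_distrib_mat_vec[of _ n n])
  have inj: "v = 0\<^sub>v n" if "v \<in> carrier_vec n" "P *\<^sub>v v = 0\<^sub>v n" for v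
  proof -
    have "v = (Q * P) *\<^sub>v v" using w(2) that by simp
    also have "\<dots> = Q *\<^sub>v (P *\<^sub>v v)" using w(6,7) that by (intro assoc_mult_mat_vec) auto
    also have "\<dots> = 0\<^sub>v n" using that w(7) by (auto intro!: eq_vecI)
    finally show ?thesis .
  qed
  obtain c0 where c0: "f0 = c0 \<cdot>\<^sub>v x" using simple[OF f(1) Af0] by blast
  have "c0 \<noteq> 0"
  proof
    assume "c0 = 0"
    then have "f0 = 0\<^sub>v n" using c0 x by auto
    then have "e0 = 0\<^sub>v n" using inj[OF e(1)] by (simp add: f0_def)
    then have "e0 $ 0 = 0\<^sub>v n $ 0" by simp
    then show False using n by (simp add: e0_def)
  qed
  \<comment> \<open>Pairing with the left eigenvector \<open>y\<close> cancels the terms in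
    \<open>k\<close> and leaves \<open>b\<close> times a nonzero number, so
    \<open>b = 0\<close>.\<close>
  have "k * (y \<bullet> f1) = y \<bullet> (b \<cdot>\<^sub>v f0 + k \<cdot>\<^sub>v f1)"
    using left[OF f(2)] by (simp add: Af1)
  also have "\<dots> = b * (y \<bullet> f0) + k * (y \<bullet> f1)"
    using y f by (simp add: scalar_prod_add_distrib[of _ n])
  finally have "b * (y \<bullet> f0) = 0" by simp
  then have "b * (c0 * (y \<bullet> x)) = 0" using y x by (simp add: c0)
  with \<open>c0 \<noteq> 0\<close> yx have "b = 0" by simp
  then have "A *\<^sub>v f1 = k \<cdot>\<^sub>v f1" using Af1 f by (auto intro!: eq_vecI)
  from simple[OF f(2) this] obtain c1 where c1: "f1 = c1 \<cdot>\<^sub>v x" by blast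
  \<comment> \<open>Both \<open>f0\<close> and \<open>f1\<close> are now multiples of
    \<open>x\<close>, so a nontrivial combination of \<open>e0\<close> and \<open>e1\<close> lies in
    the kernel of the invertible \<open>P\<close>.\<close>
  have "P *\<^sub>v (c1 \<cdot>\<^sub>v e0 - c0 \<cdot>\<^sub>v e1) = c1 \<cdot>\<^sub>v f0 - c0 \<cdot>\<^sub>v f1"
    using w(6) e by (simp add: mult_mat_vec mult_minus_distrib_mat_vec[of _ n n] f0_def f1_def)
  also have "\<dots> = 0\<^sub>v n" using x unfolding c0 c1 by (auto simp: smult_smult_assoc mult.commute)
  finally have "c1 \<cdot>\<^sub>v e0 - c0 \<cdot>\<^sub>v e1 = 0\<^sub>v n" using inj e by auto
  then have "(c1 \<cdot>\<^sub>v e0 - c0 \<cdot>\<^sub>v e1) $ 1 = 0\<^sub>v n $ 1" by simp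
  then show False using n \<open>c0 \<noteq> 0\<close> by (simp add: e0_def e1_def)
qed

section \<open>Regular digraphs with unimodular weights\<close>

text \<open>Distinctness lets the position of an entry be recovered from the entry, so eigenvectors
  can be treated as functions on the index set.\<close>

lemma vec_surj_on_list:
  assumes "distinct xs" "z \<in> carrier_vec (length xs)"
  obtains x where "z = vec (length xs) (\<lambda>i. x (xs ! i))"
proof
  let ?x = "\<lambda>v. z $ (inv_into {..<length xs} ((!) xs) v)"
  have "inj_on ((!) xs) {..<length xs}"
    using assms(1) by (auto intro: inj_on_nth)
  then show "z = vec (length xs) (\<lambda>i. ?x (xs ! i))"
    using assms(2) by (intro eq_vecI) (auto simp: inv_into_f_f)
qed

text \<open>Edges are abstract elements with two endpoint maps, so loops and parallel edges are
  covered. The locale is instantiated twice: with oriented edges over vertices and with feeding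
  pairs over oriented edges.\<close>

locale regular_weighting =
  fixes V :: "'v set" and E :: "'e set" and org ter :: "'e \<Rightarrow> 'v"
    and wt :: "'e \<Rightarrow> complex" and d :: nat
  assumes finite_V: "finite V" and finite_E: "finite E"
    and org_in: "e \<in> E \<Longrightarrow> org e \<in> V" and ter_in: "e \<in> E \<Longrightarrow> ter e \<in> V"
    and card_org: "v \<in> V \<Longrightarrow> card {e \<in> E. org e = v} = d"
    and card_ter: "v \<in> V \<Longrightarrow> card {e \<in> E. ter e = v} = d"
    and norm_wt: "e \<in> E \<Longrightarrow> cmod (wt e) = 1"
begin

definition transfer :: "('v \<Rightarrow> complex) \<Rightarrow> 'v \<Rightarrow> complex" where
  "transfer x v = (\<Sum>e \<in> {e \<in> E. org e = v}. wt e * x (ter e))"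

definition transfer_mat :: "'v list \<Rightarrow> complex mat" where
  "transfer_mat xs = mat (length xs) (length xs)
     (\<lambda>(i, j). \<Sum>e \<in> {e \<in> E. org e = xs ! i \<and> ter e = xs ! j}. wt e)"

text \<open>These are the functions for which every summand of the energy in
  \<open>energy_eq\<close> vanishes.\<close>

definition potential :: "complex \<Rightarrow> ('v \<Rightarrow> complex) \<Rightarrow> bool" where
  "potential s x \<longleftrightarrow> (\<forall>e \<in> E. wt e * x (ter e) = s * x (org e))"

lemma sum_by_org: "(\<Sum>v\<in>V. \<Sum>e \<in> {e \<in> E. org e = v}. h e) = sum h E"
  using org_in by (intro sum.group finite_V finite_E) auto

lemma sum_by_ter: "(\<Sum>v\<in>V. \<Sum>e \<in> {e \<in> E. ter e = v}. h e) = sum h E"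
  using ter_in by (intro sum.group finite_V finite_E) auto

lemma sum_org:
  fixes h :: "'v \<Rightarrow> 'c :: comm_semiring_1"
  shows "(\<Sum>e\<in>E. h (org e)) = of_nat d * sum h V"
  unfolding sum_by_org[symmetric] by (simp add: card_org sum_distrib_left)

lemma sum_ter:
  fixes h :: "'v \<Rightarrow> 'c :: comm_semiring_1"
  shows "(\<Sum>e\<in>E. h (ter e)) = of_nat d * sum h V"
  unfolding sum_by_ter[symmetric] by (simp add: card_ter sum_distrib_left)

lemma card_E: "card E = d * card V"
  using sum_org[of "\<lambda>_. 1 :: nat"] by simp

lemma sum_transfer:
  "(\<Sum>v\<in>V. y v * transfer x v) = (\<Sum>e\<in>E. y (org e) * (wt e * x (ter e)))"
  unfolding sum_by_org[symmetric] transfer_def by (simp add: sum_distrib_left)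

text \<open>Expand the squares. As \<open>wt e\<close> and \<open>s\<close> have modulus 1,
  regularity at terminal and at initial vertices turns each of the two square sums into
  \<open>d\<close> times the squared norm of \<open>x\<close>; the cross term is twice the real part
  of the pairing of \<open>s x\<close> with the transfer of \<open>x\<close>, which the eigenvalue
  equation evaluates.\<close>

lemma energy_eq:
  assumes eig: "\<And>v. v \<in> V \<Longrightarrow> transfer x v = of_real r * s * x v" and s: "cmod s = 1"
  shows "(\<Sum>e\<in>E. (cmod (wt e * x (ter e) - s * x (org e)))\<^sup>2)
           = 2 * (real d - r) * (\<Sum>v\<in>V. (cmod (x v))\<^sup>2)"
proof -
  let ?N = "\<Sum>v\<in>V. (cmod (x v))\<^sup>2"
  have ss: "cnj s * s = 1"
    using s complex_norm_square[of s] by (simp add: mult.commute)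
  have "(\<Sum>e\<in>E. cnj (s * x (org e)) * (wt e * x (ter e)))
      = (\<Sum>v\<in>V. cnj (s * x v) * transfer x v)"
    by (simp only: sum_transfer)
  also have "\<dots> = (\<Sum>v\<in>V. of_real (r * (cmod (x v))\<^sup>2))"
  proof (intro sum.cong refl)
    fix v assume "v \<in> V"
    have "cnj (s * x v) * transfer x v = (cnj s * s) * (of_real r * (x v * cnj (x v)))"
      by (simp add: eig[OF \<open>v \<in> V\<close>] mult_ac)
    then show "cnj (s * x v) * transfer x v = of_real (r * (cmod (x v))\<^sup>2)"
      by (simp add: ss complex_norm_square del: of_real_power)
  qed
  also have "\<dots> = of_real (r * ?N)" by (simp add: sum_distrib_left)
  finally have cross: "(\<Sum>e\<in>E. Re (cnj (s * x (org e)) * (wt e * x (ter e)))) = r * ?N"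
    by (metis Re_complex_of_real Re_sum)
  have "(cmod (wt e * x (ter e) - s * x (org e)))\<^sup>2
      = (cmod (x (ter e)))\<^sup>2 + (cmod (x (org e)))\<^sup>2
        - 2 * Re (cnj (s * x (org e)) * (wt e * x (ter e)))" if "e \<in> E" for e
  proof -
    have "(cmod (a - b))\<^sup>2 = (cmod a)\<^sup>2 + (cmod b)\<^sup>2 - 2 * Re (cnj b * a)" for a b
      by (simp add: cmod_power2) (simp add: power2_eq_square algebra_simps)
    from this[of "wt e * x (ter e)" "s * x (org e)"] show ?thesis
      using norm_wt[OF that] s by (simp add: norm_mult)
  qed
  then have "(\<Sum>e\<in>E. (cmod (wt e * x (ter e) - s * x (org e)))\<^sup>2)
      = (\<Sum>e\<in>E. (cmod (x (ter e)))\<^sup>2 + (cmod (x (org e)))\<^sup>2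
        - 2 * Re (cnj (s * x (org e)) * (wt e * x (ter e))))"
    by (intro sum.cong refl)
  also have "\<dots> = (\<Sum>e\<in>E. (cmod (x (ter e)))\<^sup>2) + (\<Sum>e\<in>E. (cmod (x (org e)))\<^sup>2)
        - 2 * (\<Sum>e\<in>E. Re (cnj (s * x (org e)) * (wt e * x (ter e))))"
    by (simp only: sum.distrib sum_subtractf sum_distrib_left)
  finally show ?thesis
    unfolding cross sum_ter[of "\<lambda>v. (cmod (x v))\<^sup>2"] sum_org[of "\<lambda>v. (cmod (x v))\<^sup>2"]
    by (simp add: algebra_simps)
qed

lemma transfer_potential:
  assumes "potential s x" "v \<in> V"
  shows "transfer x v = of_nat d * s * x v"
proof -
  have "transfer x v = (\<Sum>e \<in> {e \<in> E. org e = v}. s * x v)"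
    unfolding transfer_def using assms(1) by (intro sum.cong) (auto simp: potential_def)
  then show ?thesis by (simp add: card_org[OF assms(2)])
qed

text \<open>For \<open>r = d\<close> the energy is zero, hence so is each of its nonnegative
  terms.\<close>

lemma potential_if_extremal:
  assumes eig: "\<And>v. v \<in> V \<Longrightarrow> transfer x v = of_nat d * s * x v" and s: "cmod s = 1"
  shows "potential s x"
proof -
  have "(\<Sum>e\<in>E. (cmod (wt e * x (ter e) - s * x (org e)))\<^sup>2) = 0"
    using energy_eq[of x "real d" s] eig s by simp
  then show ?thesis
    using finite_E by (simp add: sum_nonneg_eq_0_iff potential_def)
qed

text \<open>With \<open>k\<close> written as its modulus times a phase \<open>s\<close>, the energy
  is nonnegative while the squared norm of \<open>x\<close> is positive, so the factor
  \<open>d - |k|\<close> cannot be negative.\<close>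

lemma eigenvalue_transfer_norm_le:
  assumes eig: "\<And>v. v \<in> V \<Longrightarrow> transfer x v = k * x v" and "w \<in> V" "x w \<noteq> 0"
  shows "cmod k \<le> real d"
proof -
  obtain s where s: "cmod s = 1" "k = of_real (cmod k) * s"
  proof (cases "k = 0")
    case True
    then show ?thesis using that[of 1] by simp
  next
    case False
    then show ?thesis using that[of "k / of_real (cmod k)"] by (simp add: norm_divide)
  qed
  have "0 \<le> (\<Sum>e\<in>E. (cmod (wt e * x (ter e) - s * x (org e)))\<^sup>2)"
    by (intro sum_nonneg) simp
  also have "\<dots> = 2 * (real d - cmod k) * (\<Sum>v\<in>V. (cmod (x v))\<^sup>2)"
    using eig s(2) by (intro energy_eq s(1)) auto
  finally have "0 \<le> (2 * (real d - cmod k)) * (\<Sum>v\<in>V. (cmod (x v))\<^sup>2)" .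
  moreover have "0 < (\<Sum>v\<in>V. (cmod (x v))\<^sup>2)"
    using assms(2,3) finite_V by (intro sum_pos2[of _ w]) auto
  ultimately show ?thesis by (simp add: zero_le_mult_iff)
qed

section \<open>The transfer operator as a matrix along an enumeration of the vertices\<close>

context
  fixes xs :: "'v list"
  assumes xs: "distinct xs" "set xs = V"
begin

lemma sum_nth: "(\<Sum>i<length xs. h (xs ! i)) = sum h V"
  using sum.reindex_bij_betw[OF bij_betw_nth[OF xs(1) refl xs(2)[symmetric]]] .

lemma transfer_mat_carrier: "transfer_mat xs \<in> carrier_mat (length xs) (length xs)"
  by (simp add: transfer_mat_def)

text \<open>The edges leaving a vertex are grouped by their terminal vertex; parallel edges have
  already been summed in the matrix entry.\<close>

lemma transfer_mat_mult_vec: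
  "transfer_mat xs *\<^sub>v vec (length xs) (\<lambda>i. x (xs ! i)) = vec (length xs) (\<lambda>i. transfer x (xs ! i))"
proof (intro eq_vecI)
  fix i assume "i < dim_vec (vec (length xs) (\<lambda>i. transfer x (xs ! i)))"
  then have i: "i < length xs" by simp
  have "(transfer_mat xs *\<^sub>v vec (length xs) (\<lambda>i. x (xs ! i))) $ i
      = (\<Sum>j<length xs. (\<Sum>e \<in> {e \<in> E. org e = xs ! i \<and> ter e = xs ! j}. wt e) * x (xs ! j))"
    using i by (simp add: transfer_mat_def scalar_prod_def lessThan_atLeast0)
  also have "\<dots> = (\<Sum>w\<in>V. (\<Sum>e \<in> {e \<in> E. org e = xs ! i \<and> ter e = w}. wt e) * x w)"
    by (rule sum_nth)
  also have "\<dots> = (\<Sum>w\<in>V. \<Sum>e \<in> {e \<in> {e \<in> E. org e = xs ! i}. ter e = w}. wt e * x (ter e))"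
    by (intro sum.cong refl) (auto simp: sum_distrib_right intro!: sum.cong)
  also have "\<dots> = (\<Sum>e \<in> {e \<in> E. org e = xs ! i}. wt e * x (ter e))"
    using finite_E finite_V ter_in by (intro sum.group) auto
  finally show "(transfer_mat xs *\<^sub>v vec (length xs) (\<lambda>i. x (xs ! i))) $ i
      = vec (length xs) (\<lambda>i. transfer x (xs ! i)) $ i"
    using i by (simp add: transfer_def)
qed (simp add: transfer_mat_def)

lemma vec_nth_eq_iff:
  "vec (length xs) (\<lambda>i. x (xs ! i)) = vec (length xs) (\<lambda>i. y (xs ! i)) \<longleftrightarrow> (\<forall>v\<in>V. x v = y v)"
  unfolding vec_eq_iff xs(2)[symmetric] all_set_conv_all_nth by simp

lemma eigenvector_transfer_mat_iff:
  "eigenvector (transfer_mat xs) (vec (length xs) (\<lambda>i. x (xs ! i))) k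
     \<longleftrightarrow> (\<exists>v\<in>V. x v \<noteq> 0) \<and> (\<forall>v\<in>V. transfer x v = k * x v)"
proof -
  let ?vec = "\<lambda>x. vec (length xs) (\<lambda>i. x (xs ! i))"
  have "?vec x = 0\<^sub>v (length xs) \<longleftrightarrow> (\<forall>v\<in>V. x v = 0)"
    using vec_nth_eq_iff[of x "\<lambda>_. 0"] by (simp add: zero_vec_def)
  moreover have "?vec (transfer x) = ?vec (\<lambda>v. k * x v) \<longleftrightarrow> (\<forall>v\<in>V. transfer x v = k * x v)"
    by (rule vec_nth_eq_iff)
  moreover have "k \<cdot>\<^sub>v ?vec x = ?vec (\<lambda>v. k * x v)" by auto
  moreover have "dim_row (transfer_mat xs) = length xs" by (simp add: transfer_mat_def)
  ultimately show ?thesis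
    unfolding eigenvector_def transfer_mat_mult_vec by auto
qed

lemma eigenvalue_transfer_mat_iff:
  "eigenvalue (transfer_mat xs) k
     \<longleftrightarrow> (\<exists>x. (\<exists>v\<in>V. x v \<noteq> 0) \<and> (\<forall>v\<in>V. transfer x v = k * x v))" (is "?L \<longleftrightarrow> ?R")
proof
  assume ?L
  then obtain z where z: "eigenvector (transfer_mat xs) z k" by (auto simp: eigenvalue_def)
  then have "z \<in> carrier_vec (length xs)" by (simp add: eigenvector_def transfer_mat_def)
  then obtain x where "z = vec (length xs) (\<lambda>i. x (xs ! i))"
    using vec_surj_on_list[OF xs(1)] by metis
  with z show ?R using eigenvector_transfer_mat_iff by blast
next
  assume ?R
  then show ?L using eigenvector_transfer_mat_iff unfolding eigenvalue_def by blast
qed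

lemma eigenvalue_norm_le:
  assumes "eigenvalue (transfer_mat xs) k"
  shows "cmod k \<le> real d"
  using assms eigenvalue_transfer_norm_le unfolding eigenvalue_transfer_mat_iff by metis

lemma eigenvalue_iff_potential:
  assumes "cmod s = 1"
  shows "eigenvalue (transfer_mat xs) (of_nat d * s) \<longleftrightarrow> (\<exists>x. (\<exists>v\<in>V. x v \<noteq> 0) \<and> potential s x)"
  unfolding eigenvalue_transfer_mat_iff
  using assms transfer_potential potential_if_extremal by meson

lemma eigenvalue_extremalE:
  assumes "eigenvalue (transfer_mat xs) k" "cmod k = real d"
  obtains s x v where "cmod s = 1" "k = of_nat d * s" "potential s x" "v \<in> V" "x v \<noteq> 0"
proof -
  obtain s where s: "cmod s = 1" "k = of_nat d * s"
  \<comment> \<open>For \<open>d = 0\<close> also \<open>k = 0\<close>, and any phase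
    serves.\<close>
  proof (cases "d = 0")
    case True
    then show ?thesis using that[of 1] assms(2) by simp
  next
    case False
    then show ?thesis using that[of "k / of_nat d"] assms(2) by (simp add: norm_divide)
  qed
  with assms(1) eigenvalue_iff_potential[OF s(1)] that show ?thesis by auto
qed

text \<open>The spectral radius is a maximum over the spectrum, which is nonempty because the matrix
  has positive size.\<close>

lemma spectral_radius_transfer_mat:
  assumes "V \<noteq> {}"
  obtains k where "eigenvalue (transfer_mat xs) k" "spectral_radius (transfer_mat xs) = cmod k"
proof -
  have "0 < length xs" using assms xs(2) by auto
  from spectral_radius_mem_max(1)[OF transfer_mat_carrier this] that show ?thesis
    by (auto simp: spectrum_def)
qed

text \<open>Apply \<open>count_spec_eq_1\<close> with \<open>u\<close> as right and its conjugate as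
  left eigenvector; their pairing is the number of vertices. The premise \<open>conn\<close> says
  that the digraph is connected when directions are ignored, and it yields the one-dimensional
  eigenspace.\<close>

lemma count_spec_transfer_mat:
  assumes pot: "potential s u" and s: "cmod s = 1" and u: "\<And>v. v \<in> V \<Longrightarrow> cmod (u v) = 1"
    and "V \<noteq> {}"
    and conn: "\<And>r :: 'v \<Rightarrow> complex. (\<And>e. e \<in> E \<Longrightarrow> r (ter e) = r (org e)) \<Longrightarrow> \<exists>c. \<forall>v\<in>V. r v = c"
  shows "count (spec (transfer_mat xs)) (of_nat d * s) = 1"
proof (rule count_spec_eq_1[OF transfer_mat_carrier])
  let ?vec = "\<lambda>x. vec (length xs) (\<lambda>i. x (xs ! i))"
  have scalar_prod: "?vec y \<bullet> ?vec x = (\<Sum>v\<in>V. y v * x v)" for x y :: "'v \<Rightarrow> complex"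
    using sum_nth[of "\<lambda>v. y v * x v"] by (simp add: scalar_prod_def lessThan_atLeast0)
  have u0: "u v \<noteq> 0" if "v \<in> V" for v using u[OF that] by auto
  have cnj_u: "cnj (u v) * u v = 1" if "v \<in> V" for v
    using u[OF that] complex_norm_square[of "u v"] by (simp add: mult.commute)
  show "eigenvector (transfer_mat xs) (?vec u) (of_nat d * s)"
    unfolding eigenvector_transfer_mat_iff
    using transfer_potential[OF pot] \<open>V \<noteq> {}\<close> u0 by blast
  show "?vec (cnj \<circ> u) \<in> carrier_vec (length xs)" by simp
  show "\<exists>c. z = c \<cdot>\<^sub>v ?vec u"
    if z: "z \<in> carrier_vec (length xs)" and eq: "transfer_mat xs *\<^sub>v z = of_nat d * s \<cdot>\<^sub>v z" for z
  proof -
    obtain x where zx: "z = ?vec x" using vec_surj_on_list[OF xs(1) z] .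
    have "?vec (transfer x) = ?vec (\<lambda>v. of_nat d * s * x v)"
      using eq unfolding zx transfer_mat_mult_vec by auto
    then have "transfer x v = of_nat d * s * x v" if "v \<in> V" for v
      using that vec_nth_eq_iff[of "transfer x" "\<lambda>v. of_nat d * s * x v"] by simp
    then have px: "potential s x" using s by (rule potential_if_extremal)
    \<comment> \<open>Both potentials satisfy the same linear relation along \<open>e\<close>, so
      the weight and \<open>s\<close> cancel in the quotient.\<close>
    have "x (ter e) / u (ter e) = x (org e) / u (org e)" if "e \<in> E" for e
    proof -
      have "wt e * x (ter e) = s * x (org e)" "wt e * u (ter e) = s * u (org e)"
        using that px pot by (auto simp: potential_def)
      then have "(wt e * x (ter e)) * (s * u (org e)) = (s * x (org e)) * (wt e * u (ter e))" by simp
      moreover have "s \<noteq> 0" "wt e \<noteq> 0" using s norm_wt[OF that] by auto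
      ultimately show ?thesis
        using u0[OF ter_in[OF that]] u0[OF org_in[OF that]] by (simp add: field_simps)
    qed
    then obtain c where "\<forall>v\<in>V. x v / u v = c" using conn[of "\<lambda>v. x v / u v"] by blast
    then have "\<forall>v\<in>V. x v = c * u v" using u0 by (auto simp: field_simps)
    then have "?vec x = ?vec (\<lambda>v. c * u v)" using vec_nth_eq_iff[of x "\<lambda>v. c * u v"] by simp
    then have "z = c \<cdot>\<^sub>v ?vec u" unfolding zx by auto
    then show ?thesis ..
  qed
  show "?vec (cnj \<circ> u) \<bullet> (transfer_mat xs *\<^sub>v z) = of_nat d * s * (?vec (cnj \<circ> u) \<bullet> z)"
    if z: "z \<in> carrier_vec (length xs)" for z
  proof -
    obtain x where zx: "z = ?vec x" using vec_surj_on_list[OF xs(1) z] .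
    have "?vec (cnj \<circ> u) \<bullet> (transfer_mat xs *\<^sub>v z) = (\<Sum>v\<in>V. cnj (u v) * transfer x v)"
      using scalar_prod[of "cnj \<circ> u" "transfer x"] unfolding zx transfer_mat_mult_vec by simp
    also have "\<dots> = (\<Sum>e\<in>E. cnj (u (org e)) * (wt e * x (ter e)))" by (rule sum_transfer)
    \<comment> \<open>Multiplying the relation for \<open>u\<close> along \<open>e\<close> by the
      conjugates of its two end values moves the weight from the initial to the terminal vertex. The
      sum then depends on terminal vertices only, and the in-degree \<open>d\<close> evaluates
      it.\<close>
    also have "\<dots> = (\<Sum>e\<in>E. s * (cnj (u (ter e)) * x (ter e)))"
    proof (intro sum.cong refl)
      fix e assume e: "e \<in> E"
      have "wt e * u (ter e) = s * u (org e)" using e pot by (auto simp: potential_def)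
      then have "(wt e * u (ter e)) * (cnj (u (org e)) * cnj (u (ter e)))
          = (s * u (org e)) * (cnj (u (org e)) * cnj (u (ter e)))" by simp
      then have "(cnj (u (ter e)) * u (ter e)) * (cnj (u (org e)) * wt e)
          = (cnj (u (org e)) * u (org e)) * (s * cnj (u (ter e)))" by (simp add: mult_ac)
      then have "cnj (u (org e)) * wt e = s * cnj (u (ter e))"
        by (simp add: cnj_u org_in ter_in e)
      then show "cnj (u (org e)) * (wt e * x (ter e)) = s * (cnj (u (ter e)) * x (ter e))"
        by (metis mult.assoc)
    qed
    also have "\<dots> = of_nat d * s * (\<Sum>v\<in>V. cnj (u v) * x v)"
      using sum_ter[of "\<lambda>v. s * (cnj (u v) * x v)"] by (simp add: sum_distrib_left mult_ac)
    finally show ?thesis using scalar_prod[of "cnj \<circ> u" x] unfolding zx by simp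
  qed
  have "?vec (cnj \<circ> u) \<bullet> ?vec u = (\<Sum>v\<in>V. 1)"
    unfolding scalar_prod[of "cnj \<circ> u" u] using cnj_u u0 by (intro sum.cong) auto
  then show "?vec (cnj \<circ> u) \<bullet> ?vec u \<noteq> 0" using \<open>V \<noteq> {}\<close> finite_V by simp
qed

end

end

section \<open>Vertex and edge operators of a graph\<close>

lemma reversed_reversed [simp]: "reversed (reversed a) = a"
  by (simp add: reversed_def)

lemma origin_reversed [simp]: "origin G (reversed a) = terminus G a"
  by (simp add: origin_def terminus_def reversed_def)

lemma terminus_reversed [simp]: "terminus G (reversed a) = origin G a"
  by (simp add: origin_def terminus_def reversed_def)

lemma reversed_in_oriented_edges [simp]:
  "reversed a \<in> oriented_edges G \<longleftrightarrow> a \<in> oriented_edges G"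
  by (cases a) (simp add: reversed_def oriented_edges_def)

text \<open>The edge set of the non-backtracking line digraph, which makes the edge matrix a
  transfer matrix.\<close>

definition feeding_pairs :: "('a, 'b) pre_digraph \<Rightarrow> ('b oedge \<times> 'b oedge) set" where
  "feeding_pairs G = {(a, b) \<in> oriented_edges G \<times> oriented_edges G. feeds_into G a b}"

text \<open>For \<open>s = 1\<close> this expresses that the character of \<open>\<omega>\<close> is trivial on cycles, for \<open>s = -1\<close> that it is
  the sign character \<open>\<theta>\<close> there.\<close>

definition gauge :: "('a, 'b) pre_digraph \<Rightarrow> complex \<Rightarrow> ('b \<Rightarrow> real) \<Rightarrow> bool" where
  "gauge G s \<omega> \<longleftrightarrow> (\<exists>u. (\<forall>v\<in>verts G. cmod (u v) = 1) \<and>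
     (\<forall>a\<in>oriented_edges G. chi G \<omega> (edge_chain a) * u (terminus G a) = s * u (origin G a)))"

context fin_digraph
begin

lemma finite_oriented_edges: "finite (oriented_edges G)"
  by (simp add: oriented_edges_def)

lemma origin_in_verts: "a \<in> oriented_edges G \<Longrightarrow> origin G a \<in> verts G"
  by (auto simp: oriented_edges_def origin_def)

lemma terminus_in_verts: "a \<in> oriented_edges G \<Longrightarrow> terminus G a \<in> verts G"
  by (auto simp: oriented_edges_def terminus_def)

text \<open>An oriented edge starts at \<open>v\<close> either as an arc leaving \<open>v\<close> or
  as the inverse of an arc entering \<open>v\<close>. A loop at \<open>v\<close> occurs in both
  ways, in agreement with its contribution 2 to the degree.\<close>

lemma card_origin:
  "card {a \<in> oriented_edges G. origin G a = v} = in_degree G v + out_degree G v"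
proof -
  have "{a \<in> oriented_edges G. origin G a = v}
      = (\<lambda>e. (e, False)) ` in_arcs G v \<union> (\<lambda>e. (e, True)) ` out_arcs G v"
    by (auto simp: oriented_edges_def origin_def in_arcs_def out_arcs_def split: if_splits)
  moreover have "card \<dots> = card (in_arcs G v) + card (out_arcs G v)"
    by (subst card_Un_disjoint) (auto simp: card_image inj_on_def)
  ultimately show ?thesis by (simp add: in_degree_def out_degree_def)
qed

lemma card_terminus:
  "card {a \<in> oriented_edges G. terminus G a = v} = in_degree G v + out_degree G v"
proof -
  have "bij_betw reversed {a \<in> oriented_edges G. origin G a = v} {a \<in> oriented_edges G. terminus G a = v}"
    by (rule bij_betw_byWitness[of _ reversed]) auto
  from bij_betw_same_card[OF this] show ?thesis by (simp add: card_origin)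
qed

lemma form_apply_edge_chain:
  assumes "a \<in> oriented_edges G"
  shows "form_apply G \<omega> (edge_chain a) = (if snd a then \<omega> (fst a) else - \<omega> (fst a))"
proof -
  have "form_apply G \<omega> (edge_chain a)
      = (\<Sum>e\<in>arcs G. if e = fst a then (if snd a then \<omega> e else - \<omega> e) else 0)"
    unfolding form_apply_def by (intro sum.cong) (auto simp: edge_chain_def)
  then show ?thesis using assms by (auto simp: oriented_edges_def)
qed

lemma chi_edge_chain:
  assumes "a \<in> oriented_edges G"
  shows "chi G \<omega> (edge_chain a) = cis (2 * pi * (if snd a then \<omega> (fst a) else - \<omega> (fst a)))"
  unfolding chi_def form_apply_edge_chain[OF assms] by (simp add: cis_conv_exp mult_ac)

lemma norm_chi_edge_chain:
  "a \<in> oriented_edges G \<Longrightarrow> cmod (chi G \<omega> (edge_chain a)) = 1"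
  by (simp add: chi_edge_chain)

lemma chi_reversed:
  assumes "a \<in> oriented_edges G"
  shows "chi G \<omega> (edge_chain a) * chi G \<omega> (edge_chain (reversed a)) = 1"
  using assms by (simp add: chi_edge_chain) (auto simp: reversed_def cis_mult)

end

locale connected_graph = fin_digraph G for G :: "('a, 'b) pre_digraph" +
  assumes conn: "Digraph_Component.connected G"
begin

lemma verts_nonempty: "verts G \<noteq> {}"
  using conn by (auto simp: Digraph_Component.connected_def strongly_connected_def)

text \<open>Connectedness is strong connectedness of the symmetrised digraph, so a walk may use arcs
  in either direction; each such step is a step along an oriented edge.\<close>

lemma connected_induct [consumes 2, case_names base step]:
  assumes "v \<in> verts G" "v0 \<in> verts G" and base: "P v0"
    and step: "\<And>a. a \<in> oriented_edges G \<Longrightarrow> P (origin G a) \<Longrightarrow> P (terminus G a)"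
  shows "P v"
proof -
  have "v0 \<rightarrow>\<^sup>*\<^bsub>with_proj (mk_symmetric G)\<^esub> v"
    using conn assms(1,2) by (auto simp: Digraph_Component.connected_def strongly_connected_def)
  then have "(v0, v) \<in> rtrancl_on (verts G) (parcs (mk_symmetric G))"
    by (simp add: reachable_def)
  then show ?thesis
  proof (induction rule: rtrancl_on_induct)
    case base
    show ?case by fact
  next
    case (step x y)
    then obtain e where e: "e \<in> arcs G" "(x, y) = (tail G e, head G e) \<or> (x, y) = (head G e, tail G e)"
      by (auto simp: parcs_mk_symmetric)
    then have "(e, True) \<in> oriented_edges G" "(e, False) \<in> oriented_edges G"
      by (simp_all add: oriented_edges_def)
    from this[THEN assms(4)] e(2) step show ?case by (auto simp: origin_def terminus_def)
  qed
qed

lemma constant_if_invariant: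
  assumes "\<And>a. a \<in> oriented_edges G \<Longrightarrow> r (terminus G a) = r (origin G a)"
  shows "\<exists>c. \<forall>v\<in>verts G. r v = c"
proof -
  obtain v0 where "v0 \<in> verts G" using verts_nonempty by auto
  have "r v = r v0" if "v \<in> verts G" for v
    using that \<open>v0 \<in> verts G\<close> by (induction rule: connected_induct) (use assms in auto)
  then show ?thesis by blast
qed

end

section \<open>The two operators of a connected regular graph\<close>

locale connected_regular_graph = connected_graph G for G :: "('a, 'b) pre_digraph" +
  fixes d :: nat and \<omega> :: "'b \<Rightarrow> real"
  assumes regular: "v \<in> verts G \<Longrightarrow> in_degree G v + out_degree G v = d"
begin

abbreviation wt :: "'b oedge \<Rightarrow> complex" where
  "wt a \<equiv> chi G \<omega> (edge_chain a)"

sublocale adj: regular_weighting "verts G" "oriented_edges G" "origin G" "terminus G" wt d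
  by unfold_locales
    (auto simp: finite_oriented_edges origin_in_verts terminus_in_verts card_origin card_terminus
      regular norm_chi_edge_chain)

text \<open>Among the \<open>d\<close> oriented edges that leave the terminal vertex of
  \<open>a\<close>, exactly one is excluded, namely \<open>reversed a\<close>; the same count at the
  initial vertex gives the in-degree. The weight of a pair is that of its second member, as in the
  edge matrix.\<close>

sublocale edge: regular_weighting "oriented_edges G" "feeding_pairs G" fst snd "\<lambda>p. wt (snd p)" "d - 1"
proof unfold_locales
  show "finite (feeding_pairs G)"
    unfolding feeding_pairs_def
    by (rule finite_subset[of _ "oriented_edges G \<times> oriented_edges G"]) (auto simp: finite_oriented_edges)
next
  fix a assume a: "a \<in> oriented_edges G"
  have "{p \<in> feeding_pairs G. fst p = a}
      = Pair a ` ({b \<in> oriented_edges G. origin G b = terminus G a} - {reversed a})"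
    using a by (auto simp: feeding_pairs_def feeds_into_def)
  then show "card {p \<in> feeding_pairs G. fst p = a} = d - 1"
    using a finite_oriented_edges
    by (simp add: card_image inj_on_def card_Diff_singleton card_origin regular terminus_in_verts)
  have "{p \<in> feeding_pairs G. snd p = a}
      = (\<lambda>b. (b, a)) ` ({b \<in> oriented_edges G. terminus G b = origin G a} - {reversed a})"
    using a by (auto simp: feeding_pairs_def feeds_into_def)
  then show "card {p \<in> feeding_pairs G. snd p = a} = d - 1"
    using a finite_oriented_edges
    by (simp add: card_image inj_on_def card_Diff_singleton card_terminus regular origin_in_verts)
qed (auto simp: finite_oriented_edges feeding_pairs_def norm_chi_edge_chain)

lemma adj_matrix_eq: "adj_matrix G vs \<omega> = adj.transfer_mat vs"
  by (simp add: adj_matrix_def adj.transfer_mat_def)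

lemma edge_matrix_eq:
  assumes "set es \<subseteq> oriented_edges G"
  shows "edge_matrix G es \<omega> = edge.transfer_mat es"
proof (rule eq_matI)
  fix i j assume "i < dim_row (edge.transfer_mat es)" "j < dim_col (edge.transfer_mat es)"
  then have ij: "i < length es" "j < length es" by (simp_all add: edge.transfer_mat_def)
  then have "{p \<in> feeding_pairs G. fst p = es ! i \<and> snd p = es ! j}
      = (if feeds_into G (es ! i) (es ! j) then {(es ! i, es ! j)} else {})"
    using assms nth_mem by (auto simp: feeding_pairs_def)
  then show "edge_matrix G es \<omega> $$ (i, j) = edge.transfer_mat es $$ (i, j)"
    using ij by (simp add: edge_matrix_def edge.transfer_mat_def)
qed (simp_all add: edge_matrix_def edge.transfer_mat_def)

lemma oriented_edges_nonempty:
  assumes "0 < d"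
  shows "oriented_edges G \<noteq> {}"
  using adj.card_E assms verts_nonempty by auto

lemma gauge_iff_potential:
  "gauge G s \<omega> \<longleftrightarrow> (\<exists>u. (\<forall>v\<in>verts G. cmod (u v) = 1) \<and> adj.potential s u)"
  by (simp add: gauge_def adj.potential_def)

text \<open>Reading a nonzero potential along an edge and back gives \<open>s\<^sup>2 = 1\<close>.\<close>

lemma gauge_of_potential:
  assumes pot: "adj.potential s x" and s: "cmod s = 1" and "v \<in> verts G" "x v \<noteq> 0" and "0 < d"
  shows "s \<in> {1, -1} \<and> gauge G s \<omega>"
proof -
  have eq: "wt a * x (terminus G a) = s * x (origin G a)" if "a \<in> oriented_edges G" for a
    using that pot by (auto simp: adj.potential_def)
  \<comment> \<open>All weights and \<open>s\<close> have modulus 1, so the modulus of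
    \<open>x\<close> is invariant along edges and hence a constant \<open>c\<close>, nonzero because
    of its value at \<open>v\<close>.\<close>
  have "cmod (x (terminus G a)) = cmod (x (origin G a))" if "a \<in> oriented_edges G" for a
    using arg_cong[OF eq[OF that], of cmod] s norm_chi_edge_chain[OF that] by (simp add: norm_mult)
  then obtain c where c: "\<forall>v\<in>verts G. cmod (x v) = c"
    using constant_if_invariant[of "\<lambda>v. cmod (x v)"] by auto
  then have "c \<noteq> 0" using assms(3,4) by auto
  obtain a where a: "a \<in> oriented_edges G" using oriented_edges_nonempty[OF \<open>0 < d\<close>] by auto
  have "x (terminus G a) = wt a * wt (reversed a) * x (terminus G a)"
    by (simp add: chi_reversed[OF a])
  also have "\<dots> = wt (reversed a) * (wt a * x (terminus G a))" by (simp add: mult_ac)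
  also have "\<dots> = s * (wt (reversed a) * x (terminus G (reversed a)))" by (simp add: eq[OF a])
  also have "\<dots> = s * (s * x (terminus G a))" using a by (subst eq) simp_all
  finally have "x (terminus G a) * (s * s - 1) = 0" by (simp add: algebra_simps)
  moreover have "x (terminus G a) \<noteq> 0" using c \<open>c \<noteq> 0\<close> terminus_in_verts[OF a] by auto
  ultimately have "(s - 1) * (s + 1) = 0" by (simp add: algebra_simps)
  then have "s \<in> {1, -1}" by (auto simp: eq_neg_iff_add_eq_0)
  moreover have "gauge G s \<omega>"
    \<comment> \<open>Dividing by the constant modulus \<open>c\<close> makes the potential
      unimodular.\<close>
    unfolding gauge_iff_potential adj.potential_def
  proof (intro exI[of _ "\<lambda>v. x v / of_real c"] conjI ballI)
    show "cmod (x v / of_real c) = 1" if "v \<in> verts G" for v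
      using c \<open>c \<noteq> 0\<close> that by (auto simp: norm_divide)
    show "wt a * (x (terminus G a) / of_real c) = s * (x (origin G a) / of_real c)"
      if "a \<in> oriented_edges G" for a
      using eq[OF that] by simp
  qed
  ultimately show ?thesis by simp
qed

text \<open>Two edges into the same vertex feed into a common edge as soon as the degree is at least 3.\<close>

lemma factor_through_terminus:
  fixes w x :: "'b oedge \<Rightarrow> complex"
  assumes "3 \<le> d" "s \<noteq> 0"
    and eq: "\<And>a b. (a, b) \<in> feeding_pairs G \<Longrightarrow> w b * x b = s * x a"
  obtains u where "\<And>a. a \<in> oriented_edges G \<Longrightarrow> x a = u (terminus G a)"
    and "\<And>a. a \<in> oriented_edges G \<Longrightarrow> w a * u (terminus G a) = s * u (origin G a)"
proof -
  have same: "x a = x a'"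
    if a: "a \<in> oriented_edges G" "a' \<in> oriented_edges G" "terminus G a = terminus G a'" for a a'
  proof -
    let ?out = "{b \<in> oriented_edges G. origin G b = terminus G a}"
    have "card {reversed a, reversed a'} < card ?out"
      using \<open>3 \<le> d\<close> card_insert_le_m1[of 2 "{reversed a'}" "reversed a"]
      by (simp add: card_origin regular terminus_in_verts a)
    then have "\<not> ?out \<subseteq> {reversed a, reversed a'}"
      using card_mono[of "{reversed a, reversed a'}" ?out] by auto
    then obtain b where "b \<in> ?out" "b \<notin> {reversed a, reversed a'}" by blast
    then have "(a, b) \<in> feeding_pairs G" "(a', b) \<in> feeding_pairs G"
      using a by (auto simp: feeding_pairs_def feeds_into_def)
    then have "s * x a = s * x a'" using eq by metis
    with \<open>s \<noteq> 0\<close> show ?thesis by simp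
  qed
  \<comment> \<open>By \<open>same\<close> the value does not depend on the chosen edge into
    \<open>v\<close>.\<close>
  define u where "u v = x (SOME a. a \<in> oriented_edges G \<and> terminus G a = v)" for v
  have xu: "x a = u (terminus G a)" if "a \<in> oriented_edges G" for a
    unfolding u_def using that
    by (intro same) (metis (mono_tags, lifting) someI_ex)+
  moreover have "w b * u (terminus G b) = s * u (origin G b)" if b: "b \<in> oriented_edges G" for b
  proof -
    \<comment> \<open>The in-degree \<open>d - 1\<close> of \<open>b\<close> is positive, so some
      \<open>a\<close> feeds into \<open>b\<close>; it ends at the initial vertex of
      \<open>b\<close>, which turns the relation for the pair into one for \<open>u\<close> along
      \<open>b\<close>.\<close>
    have "{p \<in> feeding_pairs G. snd p = b} \<noteq> {}"
    proof
      assume "{p \<in> feeding_pairs G. snd p = b} = {}"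
      with edge.card_ter[OF b] have "card {} = d - 1" by simp
      with \<open>3 \<le> d\<close> show False by simp
    qed
    then obtain a where a: "(a, b) \<in> feeding_pairs G" by auto
    then have "a \<in> oriented_edges G" "terminus G a = origin G b"
      by (auto simp: feeding_pairs_def feeds_into_def)
    then show ?thesis using eq[OF a] xu[OF b] xu[of a] by simp
  qed
  ultimately show ?thesis using that by blast
qed

lemma edge_potential_of_potential:
  "adj.potential s u \<Longrightarrow> edge.potential s (u \<circ> terminus G)"
  unfolding adj.potential_def edge.potential_def by (auto simp: feeding_pairs_def feeds_into_def)

text \<open>With trivial weights and \<open>s = 1\<close>, \<open>factor_through_terminus\<close>
  produces a function on vertices that is invariant along edges, and connectedness of
  \<open>G\<close> applies. For degree 2 the conclusion fails: on a cycle the two directions are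
  never joined by a feeding pair.\<close>

lemma edge_constant_if_invariant:
  fixes r :: "'b oedge \<Rightarrow> complex"
  assumes "3 \<le> d" "\<And>p. p \<in> feeding_pairs G \<Longrightarrow> r (snd p) = r (fst p)"
  shows "\<exists>c. \<forall>a\<in>oriented_edges G. r a = c"
proof -
  obtain u where "\<And>a. a \<in> oriented_edges G \<Longrightarrow> r a = u (terminus G a)"
    and "\<And>a. a \<in> oriented_edges G \<Longrightarrow> 1 * u (terminus G a) = 1 * u (origin G a)"
  proof (rule factor_through_terminus[OF assms(1), of 1 "\<lambda>_. 1" r])
    show "1 * r b = 1 * r a" if "(a, b) \<in> feeding_pairs G" for a b
      using assms(2)[OF that] by simp
  qed (simp, blast)
  moreover from this(2) obtain c where "\<forall>v\<in>verts G. u v = c"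
    using constant_if_invariant[of u] by auto
  ultimately show ?thesis using terminus_in_verts by (intro exI[of _ c]) simp
qed

context
  fixes vs :: "'a list"
  assumes vs: "distinct vs" "set vs = verts G"
begin

lemma adj_eigenvalue_norm_le: "eigenvalue (adj_matrix G vs \<omega>) k \<Longrightarrow> cmod k \<le> real d"
  using adj.eigenvalue_norm_le[OF vs] by (simp add: adj_matrix_eq)

lemma adj_eigenvalue_extremal:
  assumes "eigenvalue (adj_matrix G vs \<omega>) k" "cmod k = real d" "0 < d"
  shows "\<exists>s\<in>{1, -1}. k = of_nat d * s \<and> gauge G s \<omega>"
proof -
  obtain s x v where "cmod s = 1" "k = of_nat d * s" "adj.potential s x" "v \<in> verts G" "x v \<noteq> 0"
    by (rule adj.eigenvalue_extremalE[OF vs assms(1)[unfolded adj_matrix_eq] assms(2)])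
  with gauge_of_potential[of s x v] assms(3) show ?thesis by blast
qed

lemma count_spec_adj:
  assumes "gauge G s \<omega>" "cmod s = 1"
  shows "count (spec (adj_matrix G vs \<omega>)) (of_nat d * s) = 1"
proof -
  obtain u where u: "\<And>v. v \<in> verts G \<Longrightarrow> cmod (u v) = 1" "adj.potential s u"
    using assms(1) by (auto simp: gauge_iff_potential)
  show ?thesis
    unfolding adj_matrix_eq
    by (rule adj.count_spec_transfer_mat[OF vs u(2) assms(2) u(1) verts_nonempty], assumption)
      (rule constant_if_invariant)
qed

end

context
  fixes es :: "'b oedge list"
  assumes es: "distinct es" "set es = oriented_edges G"
begin

lemma edge_eigenvalue_norm_le: "eigenvalue (edge_matrix G es \<omega>) k \<Longrightarrow> cmod k \<le> real (d - 1)"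
  using edge.eigenvalue_norm_le[OF es] es(2) by (simp add: edge_matrix_eq)

lemma edge_eigenvalue_extremal:
  assumes "eigenvalue (edge_matrix G es \<omega>) k" "cmod k = real (d - 1)" "3 \<le> d"
  shows "\<exists>s\<in>{1, -1}. k = of_nat (d - 1) * s \<and> gauge G s \<omega>"
proof -
  have "eigenvalue (edge.transfer_mat es) k" using assms(1) es(2) by (simp add: edge_matrix_eq)
  then obtain s x a where s: "cmod s = 1" "k = of_nat (d - 1) * s" "edge.potential s x"
      and a: "a \<in> oriented_edges G" "x a \<noteq> 0"
    by (rule edge.eigenvalue_extremalE[OF es _ assms(2)])
  obtain u where xu: "\<And>a. a \<in> oriented_edges G \<Longrightarrow> x a = u (terminus G a)"
    and "\<And>a. a \<in> oriented_edges G \<Longrightarrow> wt a * u (terminus G a) = s * u (origin G a)"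
  proof (rule factor_through_terminus[OF assms(3)])
    show "s \<noteq> 0" using s(1) by auto
    show "wt b * x b = s * x a" if "(a, b) \<in> feeding_pairs G" for a b
      using that s(3) by (auto simp: edge.potential_def)
  qed blast
  then have "adj.potential s u" by (simp add: adj.potential_def)
  then have "s \<in> {1, -1} \<and> gauge G s \<omega>"
    by (rule gauge_of_potential[OF _ s(1) terminus_in_verts[OF a(1)]])
      (use a xu[OF a(1)] assms(3) in auto)
  with s(2) show ?thesis by blast
qed

text \<open>A vertex potential composed with \<open>terminus G\<close> is an edge potential;
  \<open>0 < d\<close> supplies an oriented edge on which it is nonzero.\<close>

lemma edge_eigenvalue_if_gauge:
  assumes "gauge G s \<omega>" "cmod s = 1" "0 < d"
  shows "eigenvalue (edge_matrix G es \<omega>) (of_nat (d - 1) * s)"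
proof -
  obtain u where u: "\<And>v. v \<in> verts G \<Longrightarrow> cmod (u v) = 1" "adj.potential s u"
    using assms(1) by (auto simp: gauge_iff_potential)
  obtain a where a: "a \<in> oriented_edges G" using oriented_edges_nonempty[OF assms(3)] by auto
  then have "u (terminus G a) \<noteq> 0" using u(1)[OF terminus_in_verts] by fastforce
  then have "\<exists>x. (\<exists>a\<in>oriented_edges G. x a \<noteq> 0) \<and> edge.potential s x"
    using a edge_potential_of_potential[OF u(2)] by (intro exI[of _ "u \<circ> terminus G"]) auto
  then have "eigenvalue (edge.transfer_mat es) (of_nat (d - 1) * s)"
    by (rule edge.eigenvalue_iff_potential[OF es assms(2), THEN iffD2])
  then show ?thesis using es(2) by (simp add: edge_matrix_eq)
qed

lemma count_spec_edge:
  assumes "gauge G s \<omega>" "cmod s = 1" "3 \<le> d"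
  shows "count (spec (edge_matrix G es \<omega>)) (of_nat (d - 1) * s) = 1"
proof -
  obtain u where u: "\<And>v. v \<in> verts G \<Longrightarrow> cmod (u v) = 1" "adj.potential s u"
    using assms(1) by (auto simp: gauge_iff_potential)
  have "count (spec (edge.transfer_mat es)) (of_nat (d - 1) * s) = 1"
  proof (rule edge.count_spec_transfer_mat[OF es edge_potential_of_potential[OF u(2)] assms(2)])
    show "cmod ((u \<circ> terminus G) a) = 1" if "a \<in> oriented_edges G" for a
      using u(1)[OF terminus_in_verts[OF that]] by simp
    show "oriented_edges G \<noteq> {}" using oriented_edges_nonempty assms(3) by simp
  qed (rule edge_constant_if_invariant[OF assms(3)])
  then show ?thesis using es(2) by (simp add: edge_matrix_eq)
qed

end

end

section \<open>Characters and gauge functions\<close>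

text \<open>Gram-Schmidt, one vector at a time: \<open>x\<close> and the new vector
  \<open>s k\<close> are first projected on the span of the earlier ones, with residues
  \<open>y\<close> and \<open>t\<close>, and then \<open>y\<close> is made orthogonal to
  \<open>t\<close>. The family may be linearly dependent.\<close>

lemma orthogonal_projection_exists:
  fixes s :: "'i \<Rightarrow> 'e \<Rightarrow> real"
  assumes "finite I" "finite E"
  shows "\<exists>c. \<forall>i\<in>I. (\<Sum>e\<in>E. (x e - (\<Sum>j\<in>I. c j * s j e)) * s i e) = 0"
  using assms(1)
proof (induction I arbitrary: x)
  case empty
  show ?case by simp
next
  case (insert k I)
  obtain c where c: "\<And>i. i \<in> I \<Longrightarrow> (\<Sum>e\<in>E. (x e - (\<Sum>j\<in>I. c j * s j e)) * s i e) = 0"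
    using insert.IH[of x] by blast
  obtain b where b: "\<And>i. i \<in> I \<Longrightarrow> (\<Sum>e\<in>E. (s k e - (\<Sum>j\<in>I. b j * s j e)) * s i e) = 0"
    using insert.IH[of "s k"] by blast
  define y where "y e = x e - (\<Sum>j\<in>I. c j * s j e)" for e
  define t where "t e = s k e - (\<Sum>j\<in>I. b j * s j e)" for e
  \<comment> \<open>If \<open>t\<close> vanishes on \<open>E\<close>, division by zero makes
    \<alpha> zero, which is the right value.\<close>
  define \<alpha> where "\<alpha> = (\<Sum>e\<in>E. y e * t e) / (\<Sum>e\<in>E. t e * t e)"
  \<comment> \<open>The coefficients are read off from \<open>y - \<alpha> t\<close>, where
    \<open>t\<close> contributes \<open>s k\<close> with coefficient 1 and the earlier vectors with
    coefficients \<open>- b j\<close>.\<close>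
  define c' where "c' j = (if j = k then \<alpha> else c j - \<alpha> * b j)" for j
  have "(\<Sum>j\<in>I. c' j * s j e) = (\<Sum>j\<in>I. c j * s j e) - \<alpha> * (\<Sum>j\<in>I. b j * s j e)" for e
  proof -
    have "(\<Sum>j\<in>I. c' j * s j e) = (\<Sum>j\<in>I. c j * s j e - \<alpha> * (b j * s j e))"
      using insert.hyps by (intro sum.cong) (auto simp: c'_def algebra_simps)
    then show ?thesis by (simp add: sum_subtractf sum_distrib_left)
  qed
  then have res: "x e - (\<Sum>j\<in>insert k I. c' j * s j e) = y e - \<alpha> * t e" for e
    using insert.hyps by (simp add: y_def t_def c'_def algebra_simps)
  have orth: "(\<Sum>e\<in>E. (y e - \<alpha> * t e) * s i e) = 0" if "i \<in> I" for i
  proof -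
    have "(\<Sum>e\<in>E. (y e - \<alpha> * t e) * s i e) = (\<Sum>e\<in>E. y e * s i e) - \<alpha> * (\<Sum>e\<in>E. t e * s i e)"
      by (simp add: algebra_simps sum_subtractf sum_distrib_left)
    then show ?thesis using b[OF that] c[OF that] by (simp add: y_def t_def)
  qed
  have "(\<Sum>e\<in>E. (y e - \<alpha> * t e) * t e) = (\<Sum>e\<in>E. y e * t e) - \<alpha> * (\<Sum>e\<in>E. t e * t e)"
    by (simp add: algebra_simps sum_subtractf sum_distrib_left)
  also have "\<dots> = 0"
  proof (cases "(\<Sum>e\<in>E. t e * t e) = 0")
    case True
    then have "\<forall>e\<in>E. t e = 0" using assms(2) by (simp add: sum_nonneg_eq_0_iff)
    then show ?thesis by simp
  qed (simp add: \<alpha>_def)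
  finally have "(\<Sum>e\<in>E. (y e - \<alpha> * t e) * t e) = 0" .
  \<comment> \<open>Since \<open>s k\<close> is \<open>t\<close> plus a combination of earlier
    vectors, orthogonality to these gives orthogonality to \<open>s k\<close>.\<close>
  moreover have "(\<Sum>e\<in>E. (y e - \<alpha> * t e) * (\<Sum>j\<in>I. b j * s j e))
      = (\<Sum>j\<in>I. b j * (\<Sum>e\<in>E. (y e - \<alpha> * t e) * s j e))"
    by (simp only: sum_distrib_left) (subst sum.swap, simp add: mult_ac)
  moreover have "(\<Sum>e\<in>E. (y e - \<alpha> * t e) * s k e)
      = (\<Sum>e\<in>E. (y e - \<alpha> * t e) * t e) + (\<Sum>e\<in>E. (y e - \<alpha> * t e) * (\<Sum>j\<in>I. b j * s j e))"
    unfolding sum.distrib[symmetric] by (simp add: t_def algebra_simps)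
  ultimately have "(\<Sum>e\<in>E. (y e - \<alpha> * t e) * s k e) = 0"
    using orth by simp
  with orth show ?case unfolding res[symmetric] by blast
qed

lemma cis_2pi_eq_1_iff: "cis (2 * pi * x) = 1 \<longleftrightarrow> x \<in> \<int>"
proof
  assume "cis (2 * pi * x) = 1"
  then have "cos (2 * pi * x) = 1" by (simp add: complex_eq_iff)
  then obtain n :: int where "2 * pi * x = of_int n * 2 * pi" using cos_one_2pi_int by auto
  then show "x \<in> \<int>" by simp
qed (rule cis_multiple_2pi)

section \<open>Harmonic decomposition and equality of character classes\<close>

context fin_digraph
begin

lemma sum_head: "(\<Sum>e\<in>arcs G. f (head G e) * c e) = (\<Sum>v\<in>verts G. f v * (\<Sum>e\<in>in_arcs G v. c e))"
  for f :: "'a \<Rightarrow> real"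
proof -
  have "(\<Sum>v\<in>verts G. \<Sum>e \<in> {e \<in> arcs G. head G e = v}. f (head G e) * c e)
      = (\<Sum>e\<in>arcs G. f (head G e) * c e)"
    by (intro sum.group) auto
  then show ?thesis by (simp add: in_arcs_def sum_distrib_left)
qed

lemma sum_tail: "(\<Sum>e\<in>arcs G. f (tail G e) * c e) = (\<Sum>v\<in>verts G. f v * (\<Sum>e\<in>out_arcs G v. c e))"
  for f :: "'a \<Rightarrow> real"
proof -
  have "(\<Sum>v\<in>verts G. \<Sum>e \<in> {e \<in> arcs G. tail G e = v}. f (tail G e) * c e)
      = (\<Sum>e\<in>arcs G. f (tail G e) * c e)"
    by (intro sum.group) auto
  then show ?thesis by (simp add: out_arcs_def sum_distrib_left)
qed

text \<open>Summation by parts: the differential of \<open>f\<close> paired with a chain is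
  \<open>f\<close> paired with the boundary of the chain.\<close>

lemma sum_exact_mult:
  fixes f :: "'a \<Rightarrow> real"
  shows "(\<Sum>e\<in>arcs G. (f (head G e) - f (tail G e)) * c e)
     = (\<Sum>v\<in>verts G. f v * ((\<Sum>e\<in>in_arcs G v. c e) - (\<Sum>e\<in>out_arcs G v. c e)))"
proof -
  have "(\<Sum>e\<in>arcs G. (f (head G e) - f (tail G e)) * c e)
      = (\<Sum>e\<in>arcs G. f (head G e) * c e) - (\<Sum>e\<in>arcs G. f (tail G e) * c e)"
    by (simp add: left_diff_distrib sum_subtractf)
  then show ?thesis
    unfolding sum_head sum_tail by (simp add: right_diff_distrib sum_subtractf)
qed

text \<open>The chain is real rather than integral, so that this serves both cycles in
  \<open>H1_int\<close> and harmonic forms, whose coefficients also form a cycle.\<close>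

lemma form_apply_exact:
  assumes "\<epsilon> \<in> exact_forms G"
    and "\<And>v. v \<in> verts G \<Longrightarrow> (\<Sum>e\<in>in_arcs G v. c e) = (\<Sum>e\<in>out_arcs G v. c e)"
  shows "form_apply G \<epsilon> c = 0"
proof -
  obtain f where "\<forall>e\<in>arcs G. \<epsilon> e = f (head G e) - f (tail G e)"
    using assms(1) by (auto simp: exact_forms_def)
  then have "form_apply G \<epsilon> c = (\<Sum>e\<in>arcs G. (f (head G e) - f (tail G e)) * c e)"
    by (simp add: form_apply_def)
  then show ?thesis using assms(2) by (simp add: sum_exact_mult)
qed

lemma form_apply_add: "form_apply G (\<lambda>e. \<omega> e + \<omega>' e) c = form_apply G \<omega> c + form_apply G \<omega>' c"
  by (simp add: form_apply_def distrib_right sum.distrib)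

lemma form_apply_diff: "form_apply G (\<lambda>e. \<omega> e - \<omega>' e) c = form_apply G \<omega> c - form_apply G \<omega>' c"
  by (simp add: form_apply_def left_diff_distrib sum_subtractf)

lemma harmonic_forms_add:
  "\<eta> \<in> harmonic_forms G \<Longrightarrow> \<eta>' \<in> harmonic_forms G \<Longrightarrow> (\<lambda>e. \<eta> e + \<eta>' e) \<in> harmonic_forms G"
  by (simp add: harmonic_forms_def one_forms_def sum.distrib)

lemma harmonic_forms_diff:
  "\<eta> \<in> harmonic_forms G \<Longrightarrow> \<eta>' \<in> harmonic_forms G \<Longrightarrow> (\<lambda>e. \<eta> e - \<eta>' e) \<in> harmonic_forms G"
  by (simp add: harmonic_forms_def one_forms_def sum_subtractf)

text \<open>The coefficients of a harmonic form are a cycle, on which exact forms vanish, so such a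
  form is orthogonal to itself.\<close>

lemma harmonic_exact_eq_0:
  assumes "\<eta> \<in> harmonic_forms G" "\<eta> \<in> exact_forms G"
  shows "\<eta> = (\<lambda>_. 0)"
proof
  fix e
  have "form_apply G \<eta> \<eta> = 0"
    using assms by (intro form_apply_exact) (auto simp: harmonic_forms_def)
  then have "\<forall>e\<in>arcs G. \<eta> e = 0" by (simp add: form_apply_def sum_nonneg_eq_0_iff)
  then show "\<eta> e = 0" using assms(2) by (auto simp: exact_forms_def one_forms_def)
qed

lemma exact_forms_diff:
  assumes "\<epsilon> \<in> exact_forms G" "\<epsilon>' \<in> exact_forms G"
  shows "(\<lambda>e. \<epsilon> e - \<epsilon>' e) \<in> exact_forms G"
proof -
  obtain f f' where "\<forall>e\<in>arcs G. \<epsilon> e = f (head G e) - f (tail G e)"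
      "\<forall>e\<in>arcs G. \<epsilon>' e = f' (head G e) - f' (tail G e)"
    using assms by (auto simp: exact_forms_def)
  then show ?thesis
    using assms unfolding exact_forms_def one_forms_def
    by (auto intro!: exI[of _ "\<lambda>v. f v - f' v"])
qed

lemma harmonic_decomposition:
  assumes "\<omega> \<in> one_forms G"
  shows "\<exists>!\<eta>. \<eta> \<in> harmonic_forms G \<and> (\<lambda>e. \<omega> e - \<eta> e) \<in> exact_forms G"
proof (rule ex_ex1I)
  \<comment> \<open>\<open>s v\<close> is the differential of the indicator function of
    \<open>v\<close>, zero on loops. These forms span the exact forms, and orthogonality to
    \<open>s v\<close> is harmonicity at \<open>v\<close>.\<close>
  define s where "s v e = (if head G e = v then 1 else 0) - (if tail G e = v then 1 else (0 :: real))" for v e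
  obtain c where c: "\<And>v. v \<in> verts G \<Longrightarrow>
      (\<Sum>e\<in>arcs G. (\<omega> e - (\<Sum>w\<in>verts G. c w * s w e)) * s v e) = 0"
    using orthogonal_projection_exists[OF finite_verts finite_arcs, of \<omega> s] by blast
  define \<eta> where "\<eta> e = (if e \<in> arcs G then \<omega> e - (c (head G e) - c (tail G e)) else 0)" for e
  have cs: "(\<Sum>w\<in>verts G. c w * s w e) = c (head G e) - c (tail G e)" if "e \<in> arcs G" for e
  proof -
    have "(\<Sum>w\<in>verts G. c w * s w e)
        = (\<Sum>w\<in>verts G. (if head G e = w then c w else 0) - (if tail G e = w then c w else 0))"
      by (intro sum.cong) (auto simp: s_def)
    also have "\<dots> = c (head G e) - c (tail G e)" using that by (simp add: sum_subtractf)
    finally show ?thesis .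
  qed
  have bd: "(\<Sum>e\<in>arcs G. \<eta> e * s v e) = (\<Sum>e\<in>in_arcs G v. \<eta> e) - (\<Sum>e\<in>out_arcs G v. \<eta> e)" for v
  proof -
    have "(\<Sum>e\<in>arcs G. \<eta> e * s v e)
        = (\<Sum>e\<in>arcs G. (if head G e = v then \<eta> e else 0) - (if tail G e = v then \<eta> e else 0))"
      by (intro sum.cong) (auto simp: s_def)
    then show ?thesis by (simp add: sum_subtractf in_arcs_def out_arcs_def sum.inter_filter)
  qed
  have "(\<Sum>e\<in>arcs G. \<eta> e * s v e) = 0" if "v \<in> verts G" for v
  proof -
    have "(\<Sum>e\<in>arcs G. \<eta> e * s v e) = (\<Sum>e\<in>arcs G. (\<omega> e - (\<Sum>w\<in>verts G. c w * s w e)) * s v e)"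
      by (intro sum.cong refl) (simp add: \<eta>_def cs)
    then show ?thesis using c[OF that] by simp
  qed
  then have "\<eta> \<in> harmonic_forms G"
    by (simp add: bd harmonic_forms_def one_forms_def) (simp add: \<eta>_def)
  moreover have "(\<lambda>e. \<omega> e - \<eta> e) \<in> exact_forms G"
    using assms by (auto simp: exact_forms_def one_forms_def \<eta>_def)
  ultimately show "\<exists>\<eta>. \<eta> \<in> harmonic_forms G \<and> (\<lambda>e. \<omega> e - \<eta> e) \<in> exact_forms G" by blast
next
  fix \<eta> \<eta>'
  assume 1: "\<eta> \<in> harmonic_forms G \<and> (\<lambda>e. \<omega> e - \<eta> e) \<in> exact_forms G"
    and 2: "\<eta>' \<in> harmonic_forms G \<and> (\<lambda>e. \<omega> e - \<eta>' e) \<in> exact_forms G"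
  have "(\<lambda>e. \<eta> e - \<eta>' e) \<in> exact_forms G"
    using exact_forms_diff[of "\<lambda>e. \<omega> e - \<eta>' e" "\<lambda>e. \<omega> e - \<eta> e"] 1 2 by simp
  moreover have "(\<lambda>e. \<eta> e - \<eta>' e) \<in> harmonic_forms G" using 1 2 by (intro harmonic_forms_diff) auto
  ultimately have "(\<lambda>e. \<eta> e - \<eta>' e) = (\<lambda>_. 0)" using harmonic_exact_eq_0 by blast
  then show "\<eta> = \<eta>'" by (simp add: fun_eq_iff)
qed

lemma
  assumes "\<omega> \<in> one_forms G"
  shows harmonic_part_harmonic: "harmonic_part G \<omega> \<in> harmonic_forms G"
    and harmonic_part_exact: "(\<lambda>e. \<omega> e - harmonic_part G \<omega> e) \<in> exact_forms G"
  using theI'[OF harmonic_decomposition[OF assms]] by (simp_all add: harmonic_part_def)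

text \<open>The exact component vanishes on cycles, so classes can be tested on the forms
  themselves, without computing the projection.\<close>

lemma form_apply_harmonic_part:
  assumes "\<omega> \<in> one_forms G" "c \<in> H1_int G"
  shows "form_apply G (harmonic_part G \<omega>) c = form_apply G \<omega> c"
  using form_apply_exact[OF harmonic_part_exact[OF assms(1)], of c] assms(2)
  by (simp add: form_apply_diff H1_int_def)

lemma H1_int_dual_add:
  "\<eta> \<in> H1_int_dual G \<Longrightarrow> \<eta>' \<in> H1_int_dual G \<Longrightarrow> (\<lambda>e. \<eta> e + \<eta>' e) \<in> H1_int_dual G"
  by (simp add: H1_int_dual_def harmonic_forms_add form_apply_add)

lemma zero_in_H1_int_dual: "(\<lambda>_. 0) \<in> H1_int_dual G"
  by (simp add: H1_int_dual_def harmonic_forms_def one_forms_def form_apply_def)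

lemma char_class_subset:
  assumes "\<omega> \<in> one_forms G" "\<omega>' \<in> one_forms G"
    and int: "\<And>c. c \<in> H1_int G \<Longrightarrow> form_apply G \<omega> c - form_apply G \<omega>' c \<in> \<int>"
  shows "char_class G \<omega> \<subseteq> char_class G \<omega>'"
proof
  fix h assume "h \<in> char_class G \<omega>"
  then obtain \<eta> where \<eta>: "\<eta> \<in> H1_int_dual G" "h = (\<lambda>e. harmonic_part G \<omega> e + \<eta> e)"
    by (auto simp: char_class_def)
  have "(\<lambda>e. harmonic_part G \<omega> e - harmonic_part G \<omega>' e) \<in> H1_int_dual G"
    using assms by (simp add: H1_int_dual_def harmonic_forms_diff harmonic_part_harmonic
      form_apply_diff form_apply_harmonic_part)
  from H1_int_dual_add[OF this \<eta>(1)] show "h \<in> char_class G \<omega>'"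
    unfolding char_class_def \<eta>(2) by (auto simp: fun_eq_iff intro!: exI)
qed

lemma char_class_eq_iff:
  assumes "\<omega> \<in> one_forms G" "\<omega>' \<in> one_forms G"
  shows "char_class G \<omega> = char_class G \<omega>' \<longleftrightarrow>
    (\<forall>c\<in>H1_int G. form_apply G (\<lambda>e. \<omega> e - \<omega>' e) c \<in> \<int>)" (is "?L \<longleftrightarrow> ?R")
proof
  assume ?L
  \<comment> \<open>The harmonic part lies in its own coset because zero lies in
    \<open>H1_int_dual\<close>.\<close>
  moreover have "harmonic_part G \<omega> \<in> char_class G \<omega>"
    unfolding char_class_def using zero_in_H1_int_dual by force
  ultimately obtain \<eta> where \<eta>: "\<eta> \<in> H1_int_dual G"
    "harmonic_part G \<omega> = (\<lambda>e. harmonic_part G \<omega>' e + \<eta> e)"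
    by (auto simp: char_class_def)
  show ?R
  proof
    fix c assume c: "c \<in> H1_int G"
    have "form_apply G \<omega> c = form_apply G \<omega>' c + form_apply G \<eta> c"
      using form_apply_harmonic_part[OF assms(1) c] form_apply_harmonic_part[OF assms(2) c]
      by (simp add: \<eta>(2) form_apply_add)
    then show "form_apply G (\<lambda>e. \<omega> e - \<omega>' e) c \<in> \<int>"
      using \<eta>(1) c by (simp add: form_apply_diff H1_int_dual_def)
  qed
next
  assume R: ?R
  have "form_apply G \<omega>' c - form_apply G \<omega> c \<in> \<int>" if "c \<in> H1_int G" for c
    using R[rule_format, OF that] Ints_minus[of "form_apply G \<omega> c - form_apply G \<omega>' c"]
    by (simp add: form_apply_diff)
  with R show ?L
    using char_class_subset[OF assms] char_class_subset[OF assms(2,1)] by (simp add: form_apply_diff)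
qed

lemma char_class_zero: "char_class G (\<lambda>_. 0) = H1_int_dual G"
proof -
  have "harmonic_part G (\<lambda>_. 0) = (\<lambda>_. 0)"
    unfolding harmonic_part_def
    by (rule the1_equality[OF harmonic_decomposition])
      (auto simp: harmonic_forms_def exact_forms_def one_forms_def)
  then show ?thesis by (simp add: char_class_def)
qed

section \<open>Gauges in terms of integer forms\<close>

lemma gauge_iff_arcs:
  assumes "s * s = 1"
  shows "gauge G s \<omega> \<longleftrightarrow> (\<exists>u. (\<forall>v\<in>verts G. cmod (u v) = 1) \<and>
    (\<forall>e\<in>arcs G. cis (2 * pi * \<omega> e) * u (head G e) = s * u (tail G e)))"
proof -
  have "(\<forall>a\<in>oriented_edges G. chi G \<omega> (edge_chain a) * u (terminus G a) = s * u (origin G a))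
    \<longleftrightarrow> (\<forall>e\<in>arcs G. cis (2 * pi * \<omega> e) * u (head G e) = s * u (tail G e))" (is "?L \<longleftrightarrow> ?R") for u
  proof
    assume L: ?L
    show ?R
    proof
      fix e assume "e \<in> arcs G"
      then have "(e, True) \<in> oriented_edges G" by (simp add: oriented_edges_def)
      from L[rule_format, OF this] this
      show "cis (2 * pi * \<omega> e) * u (head G e) = s * u (tail G e)"
        by (simp add: chi_edge_chain origin_def terminus_def)
    qed
  next
    assume R: ?R
    show ?L
    proof
      fix a assume a: "a \<in> oriented_edges G"
      then have "fst a \<in> arcs G" by (auto simp: oriented_edges_def)
      note eq = R[rule_format, OF this]
      show "chi G \<omega> (edge_chain a) * u (terminus G a) = s * u (origin G a)"
      proof (cases "snd a")
        case True
        then show ?thesis using eq a by (simp add: chi_edge_chain origin_def terminus_def)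
      next
        case False
        \<comment> \<open>Against the orientation the relation for the arc is inverted; it keeps the
          same factor \<open>s\<close> because \<open>s\<close> is its own inverse.\<close>
        have "cis (- (2 * pi * \<omega> (fst a))) * u (tail G (fst a))
            = cis (- (2 * pi * \<omega> (fst a))) * (s * s) * u (tail G (fst a))" using assms by simp
        also have "\<dots> = s * (cis (- (2 * pi * \<omega> (fst a))) * (s * u (tail G (fst a))))"
          by (simp only: mult_ac)
        also have "\<dots> = s * ((cis (- (2 * pi * \<omega> (fst a))) * cis (2 * pi * \<omega> (fst a))) * u (head G (fst a)))"
          unfolding eq[symmetric] by (simp only: mult_ac)
        also have "\<dots> = s * u (head G (fst a))" by (simp add: cis_mult)
        finally show ?thesis using False a by (simp add: chi_edge_chain origin_def terminus_def)
      qed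
    qed
  qed
  then show ?thesis unfolding gauge_def by simp
qed

lemma cis_eq_mult_iff: "cis a * cis b = cis c \<longleftrightarrow> cis (a + b - c) = 1"
proof -
  have "cis (a + b - c) = cis (a + b) / cis c" by (simp add: cis_divide)
  then show ?thesis by (simp only: cis_mult) simp
qed

lemma gauge_1_iff:
  "gauge G 1 \<omega> \<longleftrightarrow> (\<exists>f. \<forall>e\<in>arcs G. \<omega> e - (f (head G e) - f (tail G e)) \<in> \<int>)" (is "?L \<longleftrightarrow> ?R")
proof -
  have *: "cis (2 * pi * \<omega> e) * cis (- (2 * pi * f (head G e))) = cis (- (2 * pi * f (tail G e)))
    \<longleftrightarrow> \<omega> e - (f (head G e) - f (tail G e)) \<in> \<int>" for e and f :: "'a \<Rightarrow> real"
    unfolding cis_eq_mult_iff cis_2pi_eq_1_iff[symmetric] by (simp add: algebra_simps)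
  show ?thesis
  proof
    assume ?L
    then obtain u where u: "\<forall>v\<in>verts G. cmod (u v) = 1"
        "\<forall>e\<in>arcs G. cis (2 * pi * \<omega> e) * u (head G e) = 1 * u (tail G e)"
      using gauge_iff_arcs[of 1] by auto
    \<comment> \<open>The function is chosen so that \<open>u\<close> is
      \<open>exp (-2 pi i f)\<close>; the gauge relation then says that \<omega> minus the
      differential of \<open>f\<close> is integral on each arc.\<close>
    define f where "f v = - Arg (u v) / (2 * pi)" for v
    have uf: "u v = cis (- (2 * pi * f v))" if "v \<in> verts G" for v
    proof -
      have "u v \<noteq> 0" using u(1) that by auto
      then have "cis (Arg (u v)) = u v" using u(1) that by (simp add: cis_Arg sgn_div_norm)
      then show ?thesis by (simp add: f_def)
    qed
    show ?R
    proof (intro exI ballI)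
      fix e assume e: "e \<in> arcs G"
      show "\<omega> e - (f (head G e) - f (tail G e)) \<in> \<int>"
        using u(2) e by (simp add: uf *)
    qed
  next
    assume ?R
    then obtain f where "\<forall>e\<in>arcs G. \<omega> e - (f (head G e) - f (tail G e)) \<in> \<int>" by blast
    then show ?L
      unfolding gauge_iff_arcs[of 1, simplified]
      by (intro exI[of _ "\<lambda>v. cis (- (2 * pi * f v))"]) (simp add: *)
  qed
qed

text \<open>Subtracting one half on every arc divides each arc weight by \<open>cis pi\<close>, that
  is, changes its sign.\<close>

lemma gauge_minus_1_iff: "gauge G (- 1) \<omega> \<longleftrightarrow> gauge G 1 (\<lambda>e. \<omega> e - orientation_form G e)"
proof -
  have "cis (2 * pi * (\<omega> e - orientation_form G e)) * h = t \<longleftrightarrow> cis (2 * pi * \<omega> e) * h = - t"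
    if "e \<in> arcs G" for e h t
  proof -
    have "cis (2 * pi * (\<omega> e - orientation_form G e)) = cis (2 * pi * \<omega> e) / cis pi"
      using that by (simp only: cis_divide) (simp add: orientation_form_def right_diff_distrib)
    then have "cis (2 * pi * (\<omega> e - orientation_form G e)) * h = - (cis (2 * pi * \<omega> e) * h)" by simp
    then show ?thesis by (metis minus_minus)
  qed
  then show ?thesis
    unfolding gauge_iff_arcs[of 1, simplified] gauge_iff_arcs[of "- 1", simplified] by simp
qed

lemma orientation_form_in_one_forms: "orientation_form G \<in> one_forms G"
  by (simp add: orientation_form_def one_forms_def)

end

section \<open>Classes of characters in terms of gauges, and bipartiteness\<close>

context connected_graph
begin

text \<open>From right to left, differentials vanish on cycles. Conversely, \<open>f v\<close> is
  the value of \<omega> on an integral chain from a base vertex to \<open>v\<close>, and each arc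
  closes up two such chains to a cycle.\<close>

lemma integral_on_cycles_iff:
  "(\<forall>c\<in>H1_int G. form_apply G \<omega> c \<in> \<int>) \<longleftrightarrow>
   (\<exists>f. \<forall>e\<in>arcs G. \<omega> e - (f (head G e) - f (tail G e)) \<in> \<int>)" (is "?L \<longleftrightarrow> ?R")
proof
  assume ?R
  then obtain f where f: "\<forall>e\<in>arcs G. \<omega> e - (f (head G e) - f (tail G e)) \<in> \<int>" by blast
  show ?L
  proof
    fix c assume c: "c \<in> H1_int G"
    have "(\<Sum>e\<in>arcs G. (f (head G e) - f (tail G e)) * c e) = 0"
      using c unfolding sum_exact_mult by (simp add: H1_int_def)
    then have "form_apply G \<omega> c = (\<Sum>e\<in>arcs G. (\<omega> e - (f (head G e) - f (tail G e))) * c e)"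
      by (simp add: form_apply_def left_diff_distrib sum_subtractf)
    also have "\<dots> \<in> \<int>" using f c by (intro Ints_sum Ints_mult) (auto simp: H1_int_def)
    finally show "form_apply G \<omega> c \<in> \<int>" .
  qed
next
  assume L: ?L
  define bd :: "('b \<Rightarrow> real) \<Rightarrow> 'a \<Rightarrow> real"
    where "bd c v = (\<Sum>e\<in>in_arcs G v. c e) - (\<Sum>e\<in>out_arcs G v. c e)" for c v
  define ichains where "ichains = {c \<in> chains G. \<forall>e. c e \<in> \<int>}"
  have bd_edge: "bd (edge_chain a) w = (if w = terminus G a then 1 else 0) - (if w = origin G a then 1 else 0)"
    if "a \<in> oriented_edges G" for a w
  proof -
    have fin: "finite (in_arcs G w)" "finite (out_arcs G w)" by auto
    have "fst a \<in> arcs G" using that by (auto simp: oriented_edges_def)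
    then show ?thesis
      unfolding bd_def edge_chain_def sum.delta[OF fin(1)] sum.delta[OF fin(2)]
      by (auto simp: in_arcs_def out_arcs_def terminus_def origin_def)
  qed
  have edge: "edge_chain a \<in> ichains" if "a \<in> oriented_edges G" for a
    using that by (auto simp: ichains_def chains_def edge_chain_def oriented_edges_def)
  have add: "(\<lambda>e. c e + c' e) \<in> ichains" "(\<lambda>e. c e - c' e) \<in> ichains"
    if "c \<in> ichains" "c' \<in> ichains" for c c'
    using that by (simp_all add: ichains_def chains_def)
  have bd_add: "bd (\<lambda>e. c e + c' e) w = bd c w + bd c' w" "bd (\<lambda>e. c e - c' e) w = bd c w - bd c' w"
    for c c' w
    by (simp_all add: bd_def sum.distrib sum_subtractf)
  obtain v0 where v0: "v0 \<in> verts G" using verts_nonempty by auto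
  \<comment> \<open>The chain of a walk from \<open>v0\<close> to \<open>v\<close>, built by
    appending one oriented edge at a time.\<close>
  have "\<exists>c\<in>ichains. \<forall>w. bd c w = (if w = v then 1 else 0) - (if w = v0 then 1 else 0)"
    if "v \<in> verts G" for v
    using that v0
  proof (induction rule: connected_induct)
    case base
    show ?case by (intro bexI[of _ "\<lambda>_. 0"]) (auto simp: bd_def ichains_def chains_def)
  next
    case (step a)
    then obtain c where "c \<in> ichains" "\<forall>w. bd c w = (if w = origin G a then 1 else 0) - (if w = v0 then 1 else 0)"
      by blast
    then show ?case
      by (intro bexI[of _ "\<lambda>e. c e + edge_chain a e"] add edge step.hyps allI)
        (simp add: bd_add bd_edge step.hyps)
  qed
  then obtain p where p: "\<And>v. v \<in> verts G \<Longrightarrow> p v \<in> ichains"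
    "\<And>v w. v \<in> verts G \<Longrightarrow> bd (p v) w = (if w = v then 1 else 0) - (if w = v0 then 1 else 0)"
    by metis
  show ?R
  proof (intro exI ballI)
    fix e assume e: "e \<in> arcs G"
    then have a: "(e, True) \<in> oriented_edges G" by (simp add: oriented_edges_def)
    \<comment> \<open>The closed walk from \<open>v0\<close> to the tail of \<open>e\<close>, along
      \<open>e\<close>, and back from its head.\<close>
    let ?c = "\<lambda>x. (p (tail G e) x + edge_chain (e, True) x) - p (head G e) x"
    have ic: "?c \<in> ichains" using e a by (intro add edge p) auto
    have "bd ?c w = 0" for w
      using e a by (simp only: bd_add bd_edge p tail_in_verts head_in_verts)
        (simp add: origin_def terminus_def)
    then have "?c \<in> H1_int G" using ic by (auto simp: ichains_def H1_int_def bd_def)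
    with L have "form_apply G \<omega> ?c \<in> \<int>" by blast
    also have "form_apply G \<omega> ?c
        = form_apply G \<omega> (p (tail G e)) + form_apply G \<omega> (edge_chain (e, True)) - form_apply G \<omega> (p (head G e))"
      by (simp add: form_apply_def algebra_simps sum.distrib sum_subtractf)
    also have "\<dots> = \<omega> e - (form_apply G \<omega> (p (head G e)) - form_apply G \<omega> (p (tail G e)))"
      by (simp add: form_apply_edge_chain[OF a])
    finally show "\<omega> e - (form_apply G \<omega> (p (head G e)) - form_apply G \<omega> (p (tail G e))) \<in> \<int>" .
  qed
qed

lemma char_class_eq_zero_iff:
  assumes "\<omega> \<in> one_forms G"
  shows "char_class G \<omega> = zero_coset G \<longleftrightarrow> gauge G 1 \<omega>"
proof -
  have "(\<lambda>_. 0) \<in> one_forms G" by (simp add: one_forms_def)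
  from char_class_eq_iff[OF assms this] show ?thesis
    by (simp add: char_class_zero integral_on_cycles_iff gauge_1_iff)
qed

lemma char_class_eq_canonical_iff:
  assumes "\<omega> \<in> one_forms G"
  shows "char_class G \<omega> = canonical_char G \<longleftrightarrow> gauge G (- 1) \<omega>"
  unfolding canonical_char_def char_class_eq_iff[OF assms orientation_form_in_one_forms]
    integral_on_cycles_iff gauge_minus_1_iff gauge_1_iff ..

text \<open>The weight of \<open>orientation_form\<close> is -1 on every arc, so a gauge with
  \<open>s = 1\<close> is a unimodular function changing sign along each arc, and sign changes
  describe a bipartition.\<close>

lemma canonical_char_eq_zero_iff: "canonical_char G = zero_coset G \<longleftrightarrow> bipartite G"
proof -
  have "canonical_char G = zero_coset G \<longleftrightarrow> gauge G 1 (orientation_form G)"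
    unfolding canonical_char_def by (rule char_class_eq_zero_iff[OF orientation_form_in_one_forms])
  also have "cis (2 * pi * orientation_form G e) * h = t \<longleftrightarrow> t = - h" if "e \<in> arcs G" for e h t
    using that by (auto simp: orientation_form_def)
  then have "gauge G 1 (orientation_form G) \<longleftrightarrow>
      (\<exists>u. (\<forall>v\<in>verts G. cmod (u v) = 1) \<and> (\<forall>e\<in>arcs G. u (tail G e) = - u (head G e)))"
    unfolding gauge_iff_arcs[of 1, simplified] by simp
  also have "\<dots> \<longleftrightarrow> bipartite G"
  proof
    assume "\<exists>u. (\<forall>v\<in>verts G. cmod (u v) = 1) \<and> (\<forall>e\<in>arcs G. u (tail G e) = - u (head G e))"
    then obtain u where u: "\<And>v. v \<in> verts G \<Longrightarrow> cmod (u v) = 1"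
      "\<And>e. e \<in> arcs G \<Longrightarrow> u (tail G e) = - u (head G e)" by blast
    obtain v0 where v0: "v0 \<in> verts G" using verts_nonempty by auto
    then have "u v0 \<noteq> 0" using u(1) by fastforce
    \<comment> \<open>A gauge is complex valued; connectedness reduces it to two opposite values,
      distinct since \<open>u v0\<close> is nonzero.\<close>
    have vals: "u v = u v0 \<or> u v = - u v0" if "v \<in> verts G" for v
      using that v0
    proof (induction rule: connected_induct)
      case (step a)
      then have "fst a \<in> arcs G" by (auto simp: oriented_edges_def)
      then have "u (terminus G a) = - u (origin G a)"
        using u(2) by (simp add: origin_def terminus_def)
      with step show ?case by auto
    qed simp
    have "tail G e \<in> {v \<in> verts G. u v = u v0} \<and> head G e \<in> {v \<in> verts G. u v \<noteq> u v0}
      \<or> tail G e \<in> {v \<in> verts G. u v \<noteq> u v0} \<and> head G e \<in> {v \<in> verts G. u v = u v0}"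
      if "e \<in> arcs G" for e
    proof (cases "u (head G e) = u v0")
      case True
      then have "u (tail G e) \<noteq> u v0" using u(2)[OF that] \<open>u v0 \<noteq> 0\<close> by simp
      with True show ?thesis using that by simp
    next
      case False
      then have "u (head G e) = - u v0" using vals[OF head_in_verts[OF that]] by blast
      then have "u (tail G e) = u v0" using u(2)[OF that] by simp
      with False show ?thesis using that by simp
    qed
    then show "bipartite G"
      unfolding bipartite_def
      by (intro exI[of _ "{v \<in> verts G. u v = u v0}"] exI[of _ "{v \<in> verts G. u v \<noteq> u v0}"]) blast
  next
    assume "bipartite G"
    then obtain X Y where "X \<inter> Y = {}"
      "\<forall>e\<in>arcs G. (tail G e \<in> X \<and> head G e \<in> Y) \<or> (tail G e \<in> Y \<and> head G e \<in> X)"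
      by (auto simp: bipartite_def)
    then show "\<exists>u. (\<forall>v\<in>verts G. cmod (u v) = 1) \<and> (\<forall>e\<in>arcs G. u (tail G e) = - u (head G e))"
      by (intro exI[of _ "\<lambda>v. if v \<in> X then 1 else - 1"]) auto
  qed
  finally show ?thesis .
qed

end

text \<open>For \<open>q = -1\<close> the graph is a single vertex and \<open>W\<close> has size 0,
  without eigenvalues; hence the guards \<open>0 \<le> q\<close>. Multiplicity 1 for
  \<open>W\<close> is stated for \<open>g \<ge> 2\<close>: with trivial \<omega>, a cycle
  (\<open>q = 1\<close>) has the eigenvalue 1 of \<open>W\<close> twice, once for each direction,
  and a single edge joining two vertices (\<open>q = 0\<close>) has \<open>W = 0\<close> of size
  2.\<close>

theorem theorem3p4:
  fixes G :: "('a, 'b) pre_digraph" and q :: int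
    and \<omega> :: "'b \<Rightarrow> real"
    and vs :: "'a list" and es :: "'b oedge list"
  defines "A \<equiv> adj_matrix G vs \<omega>"
    and "W \<equiv> edge_matrix G es \<omega>"
    and "\<theta> \<equiv> canonical_char G"
    and "g \<equiv> genus G"
  assumes "fin_digraph G"
    and "Digraph_Component.connected G"
    and "regular_graph G (q + 1)"
    and "\<omega> \<in> one_forms G"
    and "distinct vs" and "set vs = verts G"
    and "distinct es" and "set es = oriented_edges G"
  shows "spectral_radius A \<le> of_int (q + 1) \<and> (0 \<le> q \<longrightarrow> spectral_radius W \<le> of_int q)
    \<and> (char_class G \<omega> = zero_coset G \<longrightarrow>
         count (spec A) (of_int (q + 1)) = 1
         \<and> (0 \<le> q \<longrightarrow> of_int q \<in># spec W)
         \<and> (g \<ge> 2 \<longrightarrow> count (spec W) (of_int q) = 1))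
    \<and> (char_class G \<omega> = \<theta> \<longrightarrow>
         count (spec A) (- of_int (q + 1)) = 1
         \<and> (0 \<le> q \<longrightarrow> - of_int q \<in># spec W)
         \<and> (g \<ge> 2 \<longrightarrow> count (spec W) (- of_int q) = 1))
    \<and> (char_class G \<omega> \<notin> {zero_coset G, \<theta>} \<longrightarrow>
         spectral_radius A < of_int (q + 1)
         \<and> (g \<ge> 2 \<longrightarrow> spectral_radius W < of_int q))
    \<and> (bipartite G \<longrightarrow>
         \<theta> = zero_coset G
         \<and> (g \<ge> 2 \<longrightarrow> char_class G \<omega> = zero_coset G \<longrightarrow>
              (\<forall>z \<in> set_mset (spec W) - {of_int q, - of_int q}. cmod z < of_int q)))
    \<and> (\<not> bipartite G \<longrightarrow>
         \<theta> \<noteq> zero_coset G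
         \<and> (char_class G \<omega> = zero_coset G \<longrightarrow>
              - of_int (q + 1) \<notin># spec A
              \<and> (g \<ge> 2 \<longrightarrow> (\<forall>z \<in> set_mset (spec W) - {of_int q}. cmod z < of_int q)))
         \<and> (char_class G \<omega> = \<theta> \<longrightarrow>
              of_int (q + 1) \<notin># spec A
              \<and> (g \<ge> 2 \<longrightarrow> (\<forall>z \<in> set_mset (spec W) - {- of_int q}. cmod z < of_int q))))"
proof -
  interpret fin_digraph G by fact
  interpret connected_graph G by unfold_locales fact
  obtain v where "v \<in> verts G" using verts_nonempty by auto
  with assms(7) have "0 \<le> q + 1" by (auto simp: regular_graph_def dest!: bspec)
  then obtain d where d: "q + 1 = int d" using nonneg_int_cases by metis
  interpret connected_regular_graph G d \<omega>
    using assms(7) by unfold_locales (auto simp: regular_graph_def d dest!: bspec)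
  note A = A_def and W = W_def
  note vs = \<open>distinct vs\<close> \<open>set vs = verts G\<close>
  note es = \<open>distinct es\<close> \<open>set es = oriented_edges G\<close>
  have q1: "of_int (q + 1) = (of_nat d :: complex)" "of_int (q + 1) = real d" using d by simp_all
  have q0: "of_int q = (of_nat (d - 1) :: complex)" "of_int q = real (d - 1)" "0 < d" if "0 \<le> q"
  proof -
    have "q = int (d - 1)" using d that by simp
    then show "of_int q = (of_nat (d - 1) :: complex)" "of_int q = real (d - 1)" by simp_all
    show "0 < d" using d that by simp
  qed
  \<comment> \<open>Genus at least 2 means more edges than vertices, while counting edge ends gives
    \<open>2 m = d n\<close>.\<close>
  have d3: "3 \<le> d" "0 \<le> q" if "2 \<le> g"
  proof -
    have "2 * card (arcs G) = d * card (verts G)"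
      using adj.card_E by (simp add: oriented_edges_def card_cartesian_product mult.commute)
    moreover have "card (verts G) < card (arcs G)" using that by (simp add: g_def genus_def)
    moreover have "d * card (verts G) \<le> 2 * card (verts G)" if "d \<le> 2" using that by (rule mult_le_mono1)
    ultimately show "3 \<le> d" by linarith
    then show "0 \<le> q" using d by linarith
  qed
  have zero_iff: "char_class G \<omega> = zero_coset G \<longleftrightarrow> gauge G 1 \<omega>"
    and theta_iff: "char_class G \<omega> = \<theta> \<longleftrightarrow> gauge G (- 1) \<omega>"
    unfolding \<theta>_def using assms(8) by (rule char_class_eq_zero_iff char_class_eq_canonical_iff)+
  have theta_zero: "\<theta> = zero_coset G \<longleftrightarrow> bipartite G"
    unfolding \<theta>_def by (rule canonical_char_eq_zero_iff)
  have cA: "A \<in> carrier_mat (length vs) (length vs)" and cW: "W \<in> carrier_mat (length es) (length es)"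
    by (simp_all add: A W adj_matrix_def edge_matrix_def)
  have A_le: "cmod k \<le> of_int (q + 1)" if "eigenvalue A k" for k
    using adj_eigenvalue_norm_le[OF vs] that by (simp only: A q1)
  have W_le: "cmod k \<le> of_int q" if "eigenvalue W k" "0 \<le> q" for k
    using edge_eigenvalue_norm_le[OF es] that by (simp only: W q0)
  have A_ext: "k = of_int (q + 1) \<and> gauge G 1 \<omega> \<or> k = - of_int (q + 1) \<and> gauge G (- 1) \<omega>"
    if "eigenvalue A k" "cmod k = of_int (q + 1)" "0 < d" for k
  proof -
    have "eigenvalue (adj_matrix G vs \<omega>) k" "cmod k = real d" using that by (simp_all only: A q1)
    from adj_eigenvalue_extremal[OF vs this that(3)] show ?thesis unfolding q1 by auto
  qed
  have W_ext: "k = of_int q \<and> gauge G 1 \<omega> \<or> k = - of_int q \<and> gauge G (- 1) \<omega>"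
    if "eigenvalue W k" "cmod k = of_int q" "2 \<le> g" for k
  proof -
    note q0' = q0[OF d3(2)[OF that(3)]]
    have "eigenvalue (edge_matrix G es \<omega>) k" "cmod k = real (d - 1)"
      using that(1,2) by (simp_all only: W q0')
    from edge_eigenvalue_extremal[OF es this d3(1)[OF that(3)]] show ?thesis unfolding q0' by auto
  qed
  \<comment> \<open>Without edges every form has class zero, so the strict bound on \<open>A\<close>
    is only claimed for positive degree.\<close>
  have gauge0: "gauge G 1 \<omega>" if "d = 0"
  proof -
    have "oriented_edges G = {}" using adj.card_E that finite_oriented_edges by simp
    then show ?thesis by (auto simp: gauge_def intro!: exI[of _ "\<lambda>_. 1"])
  qed
  have rho_A: "\<exists>k. eigenvalue A k \<and> spectral_radius A = cmod k"
    using adj.spectral_radius_transfer_mat[OF vs verts_nonempty] by (metis A adj_matrix_eq)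
  have rho_W: "\<exists>k. eigenvalue W k \<and> spectral_radius W = cmod k" if "0 \<le> q"
  proof -
    have "W = edge.transfer_mat es" using es(2) by (simp add: W edge_matrix_eq)
    moreover have "oriented_edges G \<noteq> {}" using oriented_edges_nonempty q0(3)[OF that] by simp
    ultimately show ?thesis using edge.spectral_radius_transfer_mat[OF es] by metis
  qed
  have bound: "spectral_radius A \<le> of_int (q + 1)" "0 \<le> q \<longrightarrow> spectral_radius W \<le> of_int q"
    using rho_A rho_W A_le W_le by fastforce+
  \<comment> \<open>Parts (a) and (b) at once, for \<open>s = 1\<close> and
    \<open>s = -1\<close>.\<close>
  have ac: "count (spec A) (of_int (q + 1) * s) = 1
      \<and> (0 \<le> q \<longrightarrow> of_int q * s \<in># spec W) \<and> (2 \<le> g \<longrightarrow> count (spec W) (of_int q * s) = 1)"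
    if "gauge G s \<omega>" "cmod s = 1" for s
  proof (intro conjI impI)
    show "count (spec A) (of_int (q + 1) * s) = 1"
      unfolding A q1 by (rule count_spec_adj[OF vs that])
    show "of_int q * s \<in># spec W" if "0 \<le> q"
      unfolding mset_spec_eigenvalue[OF cW] unfolding q0(1)[OF that] W
      by (rule edge_eigenvalue_if_gauge[OF es \<open>gauge G s \<omega>\<close> \<open>cmod s = 1\<close> q0(3)[OF that]])
    show "count (spec W) (of_int q * s) = 1" if "2 \<le> g"
      unfolding q0(1)[OF d3(2)[OF that]] W
      by (rule count_spec_edge[OF es \<open>gauge G s \<omega>\<close> \<open>cmod s = 1\<close> d3(1)[OF that]])
  qed
  have strict_A: "spectral_radius A < of_int (q + 1)" if "\<not> gauge G 1 \<omega>" "\<not> gauge G (- 1) \<omega>"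
  proof -
    obtain k where k: "eigenvalue A k" "spectral_radius A = cmod k" using rho_A by blast
    have "0 < d" using gauge0 that(1) by blast
    then have "cmod k \<noteq> of_int (q + 1)" using A_ext[OF k(1)] that by blast
    with A_le[OF k(1)] k(2) show ?thesis by simp
  qed
  have strict_W: "spectral_radius W < of_int q" if "\<not> gauge G 1 \<omega>" "\<not> gauge G (- 1) \<omega>" "2 \<le> g"
  proof -
    note q_nonneg = d3(2)[OF that(3)]
    obtain k where k: "eigenvalue W k" "spectral_radius W = cmod k" using rho_W[OF q_nonneg] by blast
    have "cmod k \<noteq> of_int q" using W_ext[OF k(1)] that by blast
    with W_le[OF k(1) q_nonneg] k(2) show ?thesis by simp
  qed
  \<comment> \<open>Serves (d) and (e): each of the two extremal values is ruled out either because
    \<open>z\<close> differs from it or because the corresponding gauge does not exist.\<close>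
  have inner_W: "cmod z < of_int q"
    if "z \<in># spec W" "2 \<le> g" "z = of_int q \<Longrightarrow> \<not> gauge G 1 \<omega>" "z = - of_int q \<Longrightarrow> \<not> gauge G (- 1) \<omega>"
    for z
  proof -
    have z: "eigenvalue W z" using that(1) mset_spec_eigenvalue[OF cW] by simp
    have "cmod z \<noteq> of_int q" using W_ext[OF z _ that(2)] that(3,4) by blast
    with W_le[OF z d3(2)[OF that(2)]] show ?thesis by simp
  qed
  have d_pos: "0 < d" if "\<not> bipartite G"
  proof (rule ccontr)
    assume "\<not> 0 < d"
    then have "oriented_edges G = {}" using adj.card_E finite_oriented_edges by simp
    then have "arcs G = {}" by (simp add: oriented_edges_def)
    then have "bipartite G" unfolding bipartite_def by (intro exI[of _ "verts G"] exI[of _ "{}"]) simp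
    with that show False by simp
  qed
  \<comment> \<open>Both gauges together would identify \<theta> with the zero coset, which happens
    only for bipartite graphs.\<close>
  have excl: "\<not> (gauge G 1 \<omega> \<and> gauge G (- 1) \<omega>)" if "\<not> bipartite G"
    using that zero_iff theta_iff theta_zero by metis
  have not_A: "k \<notin># spec A"
    if "\<not> bipartite G" "cmod k = of_int (q + 1)" "k = of_int (q + 1) \<Longrightarrow> \<not> gauge G 1 \<omega>"
      "k = - of_int (q + 1) \<Longrightarrow> \<not> gauge G (- 1) \<omega>" for k
    using A_ext[of k] that d_pos mset_spec_eigenvalue[OF cA] by blast
  have ne: "of_int (q + 1) \<noteq> (- of_int (q + 1) :: complex)" if "\<not> bipartite G"
    using d_pos[OF that] by (simp add: q1 eq_neg_iff_add_eq_0 del: of_int_add)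
  have norm_q1: "cmod (of_int (q + 1)) = of_int (q + 1)" "cmod (- of_int (q + 1)) = of_int (q + 1)"
    unfolding q1 by simp_all
  show ?thesis
    unfolding zero_iff theta_iff insert_iff empty_iff
  proof (intro conjI impI ballI)
    show "spectral_radius A \<le> of_int (q + 1)" "0 \<le> q \<Longrightarrow> spectral_radius W \<le> of_int q"
      using bound by auto
  next
    assume "gauge G 1 \<omega>"
    from ac[OF this] show "count (spec A) (of_int (q + 1)) = 1" "0 \<le> q \<Longrightarrow> of_int q \<in># spec W"
      "2 \<le> g \<Longrightarrow> count (spec W) (of_int q) = 1" by auto
  next
    assume "gauge G (- 1) \<omega>"
    from ac[OF this] show "count (spec A) (- of_int (q + 1)) = 1" "0 \<le> q \<Longrightarrow> - of_int q \<in># spec W"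
      "2 \<le> g \<Longrightarrow> count (spec W) (- of_int q) = 1"
      by (simp_all del: of_int_add)
  next
    assume "\<not> (gauge G 1 \<omega> \<or> gauge G (- 1) \<omega> \<or> False)"
    then show "spectral_radius A < of_int (q + 1)" "2 \<le> g \<Longrightarrow> spectral_radius W < of_int q"
      using strict_A strict_W by auto
  next
    assume "bipartite G"
    then show "\<theta> = zero_coset G" using theta_zero by simp
    show "cmod z < of_int q" if "2 \<le> g" "z \<in> set_mset (spec W) - {of_int q, - of_int q}" for z
      using that by (intro inner_W) auto
  next
    assume nb: "\<not> bipartite G"
    then show "\<theta> \<noteq> zero_coset G" using theta_zero by simp
    show "- of_int (q + 1) \<notin># spec A" if "gauge G 1 \<omega>"
      using that excl[OF nb] ne[OF nb] by (intro not_A[OF nb norm_q1(2)]) auto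
    show "cmod z < of_int q" if "gauge G 1 \<omega>" "2 \<le> g" "z \<in> set_mset (spec W) - {of_int q}" for z
      using that excl[OF nb] by (intro inner_W) auto
    show "of_int (q + 1) \<notin># spec A" if "gauge G (- 1) \<omega>"
      using that excl[OF nb] ne[OF nb] by (intro not_A[OF nb norm_q1(1)]) auto
    show "cmod z < of_int q" if "gauge G (- 1) \<omega>" "2 \<le> g" "z \<in> set_mset (spec W) - {- of_int q}" for z
      using that excl[OF nb] by (intro inner_W) auto
  qed
qed

end
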